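(* For constrained delegation with laminar states there is a polynomial-time algorithm to compute an optimal decision scheme $\psi^*$.
   Context: Constrained delegation. An instance consists of a finite set $\Theta$ of states partitioned as $\Theta=\Theta_A\sqcup\Theta_R$ (acceptable and rejectable states), a finite set $\Sigma$ of signals, rational probabilities $q_\theta>0$ with $\sum_\theta q_\theta=1$, and a bipartite graph $H=(\Theta\cup\Sigma,E)$, $E\subseteq\Theta\times\Sigma$, without isolated vertices; $(\theta,\sigma)\in E$ means that $\sigma$ may be sent in state $\theta$, and $N(\cdot)$ denotes neighborhoods. The receiver commits to a decision scheme $\psi:\Sigma\to[0,1]$, where $\psi(\sigma)$ is the probability of accepting upon signal $\sigma$. In state $\theta$ the sender then sends a signal in $N(\theta)$ maximizing the acceptance probability. The receiver gets $1$ for accepting in a state of $\Theta_A$ or rejecting in a state of $\Theta_R$, and $0$ otherwise, so her utility is $$U_r(\psi)=\sum_{\theta\in\Theta_A}q_\theta\max_{\sigma\in N(\theta)}\psi(\sigma)+\sum_{\theta\in\Theta_R}q_\theta\Big(1-\max_{\sigma\in N(\theta)}\psi(\sigma)\Big).$$ An optimal decision scheme $\psi^*$ maximizes $U_r$. Laminar states: the family $\{N(\sigma)\mid\sigma\in\Sigma\}$ of subsets of $\Theta$ is laminar, i.e., any two of its members are either disjoint or one contains the other. *)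

theory Defs
  imports
    Complex_Main
    "HOL-Library.FuncSet"
    "HOL-Library.Log_Nat"
    "HOL-Computational_Algebra.Polynomial"
begin

section \<open>Constrained delegation\<close>

record ('s, 'g) delegation =
  acceptable :: "'s set"
  rejectable :: "'s set"
  signals :: "'g set"
  prob :: "'s \<Rightarrow> rat"
  edges :: "('s \<times> 'g) set"

definition states :: "('s, 'g) delegation \<Rightarrow> 's set" where
  "states I = acceptable I \<union> rejectable I"

definition nbrs_state :: "('s, 'g) delegation \<Rightarrow> 's \<Rightarrow> 'g set" where
  "nbrs_state I \<theta> = {\<sigma>. (\<theta>, \<sigma>) \<in> edges I}"

definition nbrs_signal :: "('s, 'g) delegation \<Rightarrow> 'g \<Rightarrow> 's set" where
  "nbrs_signal I \<sigma> = {\<theta>. (\<theta>, \<sigma>) \<in> edges I}"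

definition delegation_instance :: "('s, 'g) delegation \<Rightarrow> bool" where
  "delegation_instance I \<longleftrightarrow>
     finite (states I) \<and> finite (signals I) \<and>
     acceptable I \<inter> rejectable I = {} \<and>
     (\<forall>\<theta>\<in>states I. prob I \<theta> > 0) \<and> (\<Sum>\<theta>\<in>states I. prob I \<theta>) = 1 \<and>
     edges I \<subseteq> states I \<times> signals I \<and>
     (\<forall>\<theta>\<in>states I. nbrs_state I \<theta> \<noteq> {}) \<and> (\<forall>\<sigma>\<in>signals I. nbrs_signal I \<sigma> \<noteq> {})"

definition laminar :: "'a set set \<Rightarrow> bool" where
  "laminar F \<longleftrightarrow> (\<forall>X\<in>F. \<forall>Y\<in>F. X \<inter> Y = {} \<or> X \<subseteq> Y \<or> Y \<subseteq> X)"

definition laminar_states :: "('s, 'g) delegation \<Rightarrow> bool" where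
  "laminar_states I \<longleftrightarrow> laminar (nbrs_signal I ` signals I)"

text \<open>A decision scheme is a total function of which only the values on the signals matter.\<close>

definition decision_schemes :: "('s, 'g) delegation \<Rightarrow> ('g \<Rightarrow> real) set" where
  "decision_schemes I = signals I \<rightarrow> {0..1}"

definition receiver_utility :: "('s, 'g) delegation \<Rightarrow> ('g \<Rightarrow> real) \<Rightarrow> real" where
  "receiver_utility I \<psi> =
     (\<Sum>\<theta>\<in>acceptable I. of_rat (prob I \<theta>) * Max (\<psi> ` nbrs_state I \<theta>)) +
     (\<Sum>\<theta>\<in>rejectable I. of_rat (prob I \<theta>) * (1 - Max (\<psi> ` nbrs_state I \<theta>)))"

definition optimal_scheme :: "('s, 'g) delegation \<Rightarrow> ('g \<Rightarrow> real) \<Rightarrow> bool" where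
  "optimal_scheme I \<psi> \<longleftrightarrow> is_arg_max (receiver_utility I) (\<lambda>\<phi>. \<phi> \<in> decision_schemes I) \<psi>"


section \<open>A random access machine with logarithmic cost\<close>

text \<open>
  The machine model is the random access machine with a random-access read-only input, a
  write-only output tape and a memory of cells that hold natural numbers, under the
  logarithmic cost criterion: executing an instruction costs the total binary length of all
  addresses and values it accesses. Control flow is structured. With this cost measure
  multiplication can be an instruction, and polynomial time coincides with polynomial time
  on Turing machines.
\<close>

text \<open>The length of the binary representation, where that of 0 is the one-digit string 0.\<close>

definition bit_length :: "nat \<Rightarrow> nat" where
  "bit_length n = max 1 (floorlog 2 n)"

definition input_size :: "nat list \<Rightarrow> nat" where
  "input_size x = sum_list (map bit_length x)"

type_synonym memory = "nat \<Rightarrow> nat"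

text \<open>Input cell 0 holds the length of the input; the input itself starts at input cell 1.\<close>

definition input_cell :: "nat list \<Rightarrow> nat \<Rightarrow> nat" where
  "input_cell x i = (if i \<le> length x then (length x # x) ! i else 0)"

text \<open>
  Operands are constants, memory cells with a fixed address, memory cells whose address is
  the content of another cell, and input cells whose address is the content of a memory cell.
\<close>

datatype operand = Const nat | Reg nat | Ind nat | Inp nat

fun operand_val :: "nat list \<Rightarrow> memory \<Rightarrow> operand \<Rightarrow> nat" where
  "operand_val x s (Const k) = k"
| "operand_val x s (Reg r) = s r"
| "operand_val x s (Ind r) = s (s r)"
| "operand_val x s (Inp r) = input_cell x (s r)"

fun operand_cost :: "nat list \<Rightarrow> memory \<Rightarrow> operand \<Rightarrow> nat" where
  "operand_cost x s (Const k) = bit_length k"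
| "operand_cost x s (Reg r) = bit_length r + bit_length (s r)"
| "operand_cost x s (Ind r) = bit_length r + bit_length (s r) + bit_length (s (s r))"
| "operand_cost x s (Inp r) = bit_length r + bit_length (s r) + bit_length (input_cell x (s r))"

text \<open>Subtraction is truncated at 0.\<close>

datatype arith_op = Add | Sub | Mul

fun arith_val :: "arith_op \<Rightarrow> nat \<Rightarrow> nat \<Rightarrow> nat" where
  "arith_val Add a b = a + b"
| "arith_val Sub a b = a - b"
| "arith_val Mul a b = a * b"

text \<open>
  \<open>Store r a\<close> writes to the cell whose address is the content of cell \<open>r\<close>; \<open>Write a\<close>
  appends to the output tape; \<open>IfLess a b\<close> and \<open>WhileLess a b\<close> test whether the value of
  \<open>a\<close> is less than that of \<open>b\<close>.
\<close>

datatype com =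
    Skip
  | Assign nat arith_op operand operand
  | Store nat operand
  | Write operand
  | Seq com com
  | IfLess operand operand com com
  | WhileLess operand operand com

text \<open>
  \<open>exec x c (s, y) t (s', y')\<close>: on input \<open>x\<close>, the program \<open>c\<close> started with memory \<open>s\<close> and
  output \<open>y\<close> halts after cost \<open>t\<close> with memory \<open>s'\<close> and output \<open>y'\<close>.
\<close>

inductive exec ::
  "nat list \<Rightarrow> com \<Rightarrow> memory \<times> nat list \<Rightarrow> nat \<Rightarrow> memory \<times> nat list \<Rightarrow> bool" for x where
  Skip: "exec x Skip (s, y) 1 (s, y)"
| Assign: "exec x (Assign r f a b) (s, y)
     (bit_length r + operand_cost x s a + operand_cost x s b)
     (s(r := arith_val f (operand_val x s a) (operand_val x s b)), y)"
| Store: "exec x (Store r a) (s, y)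
     (bit_length r + bit_length (s r) + operand_cost x s a)
     (s(s r := operand_val x s a), y)"
| Write: "exec x (Write a) (s, y) (operand_cost x s a) (s, y @ [operand_val x s a])"
| Seq: "exec x c1 p t1 p' \<Longrightarrow> exec x c2 p' t2 p'' \<Longrightarrow> exec x (Seq c1 c2) p (t1 + t2) p''"
| IfTrue: "operand_val x s a < operand_val x s b \<Longrightarrow> exec x c1 (s, y) t p \<Longrightarrow>
     exec x (IfLess a b c1 c2) (s, y) (operand_cost x s a + operand_cost x s b + t) p"
| IfFalse: "\<not> operand_val x s a < operand_val x s b \<Longrightarrow> exec x c2 (s, y) t p \<Longrightarrow>
     exec x (IfLess a b c1 c2) (s, y) (operand_cost x s a + operand_cost x s b + t) p"
| WhileTrue: "operand_val x s a < operand_val x s b \<Longrightarrow> exec x c (s, y) t1 p \<Longrightarrow>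
     exec x (WhileLess a b c) p t2 p' \<Longrightarrow>
     exec x (WhileLess a b c) (s, y) (operand_cost x s a + operand_cost x s b + t1 + t2) p'"
| WhileFalse: "\<not> operand_val x s a < operand_val x s b \<Longrightarrow>
     exec x (WhileLess a b c) (s, y) (operand_cost x s a + operand_cost x s b) (s, y)"

inductive_cases SkipE: "exec x Skip p t p'"
  and AssignE: "exec x (Assign r f a b) p t p'"
  and StoreE: "exec x (Store r a) p t p'"
  and WriteE: "exec x (Write a) p t p'"
  and SeqE: "exec x (Seq c1 c2) p t p'"
  and IfE: "exec x (IfLess a b c1 c2) p t p'"
  and WhileE: "exec x (WhileLess a b c) p t p'"

lemma exec_deterministic:
  "exec x c p t p' \<Longrightarrow> exec x c p u p'' \<Longrightarrow> u = t \<and> p'' = p'"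
proof (induction arbitrary: u p'' rule: exec.induct)
  case (Skip s y)
  then show ?case by (rule SkipE) simp
next
  case (Assign r f a b s y)
  then show ?case by (rule AssignE) simp
next
  case (Store r a s y)
  then show ?case by (rule StoreE) simp
next
  case (Write a s y)
  then show ?case by (rule WriteE) simp
next
  case (Seq c1 p t1 p' c2 t2 p3)
  from Seq.prems show ?case
  proof (rule SeqE)
    fix v1 q v2
    assume u: "u = v1 + v2" and 1: "exec x c1 p v1 q" and 2: "exec x c2 q v2 p''"
    from Seq.IH(1)[OF 1] have eq: "v1 = t1" "q = p'" by blast+
    from Seq.IH(2)[OF 2[unfolded eq]] u eq show ?thesis by blast
  qed
next
  case (IfTrue s a b c1 y t p c2)
  from IfTrue.prems show ?case by (rule IfE) (use IfTrue.hyps in \<open>auto dest: IfTrue.IH\<close>)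
next
  case (IfFalse s a b c2 y t p c1)
  from IfFalse.prems show ?case by (rule IfE) (use IfFalse.hyps in \<open>auto dest: IfFalse.IH\<close>)
next
  case (WhileTrue s a b c y t1 p t2 p')
  from WhileTrue.prems show ?case
  proof (rule WhileE, goal_cases)
    case (1 s' y' v1 q v2)
    from 1 have "exec x c (s, y) v1 q" by simp
    then have eq: "v1 = t1" "q = p" using WhileTrue.IH(1) by blast+
    from 1 have "exec x (WhileLess a b c) p v2 p''" unfolding eq by blast
    then have "v2 = t2" "p'' = p'" using WhileTrue.IH(2) by blast+
    with 1 eq show ?case by simp
  qed (use WhileTrue.hyps in auto)
next
  case (WhileFalse s a b c y)
  from WhileFalse.prems show ?case by (rule WhileE) (use WhileFalse.hyps in simp_all)
qed

text \<open>
  On input \<open>x\<close>, started with all memory cells 0 and an empty output tape, \<open>c\<close> halts with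
  output \<open>y\<close> after cost \<open>t\<close>.
\<close>

definition computes :: "com \<Rightarrow> nat list \<Rightarrow> nat list \<Rightarrow> nat \<Rightarrow> bool" where
  "computes c x y t \<longleftrightarrow> (\<exists>s. exec x c (\<lambda>_. 0, []) t (s, y))"


section \<open>Encoding of instances and decision schemes\<close>

text \<open>
  Encodings are relative to an enumeration of the states and one of the signals. A
  nonnegative rational is encoded by its numerator and denominator in lowest terms.
\<close>

definition enumerates :: "'a list \<Rightarrow> 'a set \<Rightarrow> bool" where
  "enumerates xs A \<longleftrightarrow> distinct xs \<and> set xs = A"

definition encode_rat :: "rat \<Rightarrow> nat list" where
  "encode_rat r = [nat (fst (quotient_of r)), nat (snd (quotient_of r))]"

definition encode_instance :: "('s, 'g) delegation \<Rightarrow> 's list \<Rightarrow> 'g list \<Rightarrow> nat list" where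
  "encode_instance I ts ss =
     [length ts, length ss] @
     map (\<lambda>\<theta>. of_bool (\<theta> \<in> acceptable I)) ts @
     concat (map (\<lambda>\<theta>. encode_rat (prob I \<theta>)) ts) @
     concat (map (\<lambda>\<theta>. map (\<lambda>\<sigma>. of_bool ((\<theta>, \<sigma>) \<in> edges I)) ss) ts)"

definition encode_scheme :: "('g \<Rightarrow> rat) \<Rightarrow> 'g list \<Rightarrow> nat list" where
  "encode_scheme \<psi> ss = concat (map (\<lambda>\<sigma>. encode_rat (\<psi> \<sigma>)) ss)"

end

theory Submission
  imports Defs
begin

text \<open>
  By the layer cake formula some optimal scheme is deterministic, so it suffices to find a set of
  signals for which the union of the neighbourhoods has maximum weight, where an acceptable state
  counts with weight \<open>q\<close> and a rejectable one with \<open>- q\<close>. Laminarity makes a greedy algorithm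
  correct: treat the signals in the order of the sizes of their neighbourhoods, and add the
  neighbourhood of a signal to the set \<open>C\<close> of covered states whenever its uncovered part has
  positive weight. A signal is finally accepted iff its neighbourhood is contained in \<open>C\<close>. The
  weights are computed as fractions over the product of the denominators, the bit length of
  which is at most the size of the input.
\<close>

section \<open>Reasoning about random access machines\<close>

text \<open>Ordering by size is enough because it refines strict inclusion: a neighbourhood treated
  before \<open>N j\<close> is contained in \<open>N j\<close> or disjoint from it, so the decision
  about \<open>N j\<close> concerns only what happens inside \<open>N j\<close>. Sorting is avoided
  by a round over all signals for each size, which makes about \<open>n * m\<close> scans of
  \<open>n\<close> states each. The obstacle is the machine: it has natural numbers with truncated
  subtraction and no division, and it charges for the bit length of everything it touches. Therefore
  the positive and the negative part of a weight are kept as two numerators over a common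
  denominator, and fractions are never reduced. Every scan starts them afresh, so that the
  denominator cannot pass the product of all denominators. All cells then stay below
  \<open>2 ^ b\<close>, where \<open>b\<close> is the input size plus 5; every instruction costs at
  most \<open>7 * b\<close>, and the running time becomes a matter of counting instructions.\<close>

lemma less_two_power_bit_length: "v < 2 ^ bit_length v"
proof -
  have "v < 2 ^ floorlog 2 v"
    using floorlog_le_iff[of 2 v "floorlog 2 v"] by simp
  also have "\<dots> \<le> 2 ^ bit_length v"
    by (rule power_increasing) (simp_all add: bit_length_def)
  finally show ?thesis .
qed

lemma bit_length_leI: "1 \<le> b \<Longrightarrow> v < 2 ^ b \<Longrightarrow> bit_length v \<le> b"
  by (simp add: bit_length_def floorlog_le_iff)

text \<open>
  Literals below 32 have bit length at most 5, and so at most \<open>b\<close> in \<open>bounded_ram\<close> below.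
\<close>

fun small_operand :: "operand \<Rightarrow> bool" where
  "small_operand (Const k) \<longleftrightarrow> k < 32"
| "small_operand (Reg r) \<longleftrightarrow> r < 32"
| "small_operand (Ind r) \<longleftrightarrow> r < 32"
| "small_operand (Inp r) \<longleftrightarrow> r < 32"

fun small_com :: "com \<Rightarrow> bool" where
  "small_com Skip \<longleftrightarrow> True"
| "small_com (Assign r f a b) \<longleftrightarrow> r < 32 \<and> small_operand a \<and> small_operand b"
| "small_com (Store r a) \<longleftrightarrow> r < 32 \<and> small_operand a"
| "small_com (Write a) \<longleftrightarrow> small_operand a"
| "small_com (Seq c1 c2) \<longleftrightarrow> small_com c1 \<and> small_com c2"
| "small_com (IfLess a b c1 c2) \<longleftrightarrow> small_operand a \<and> small_operand b \<and> small_com c1 \<and> small_com c2"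
| "small_com (WhileLess a b c) \<longleftrightarrow> small_operand a \<and> small_operand b \<and> small_com c"

text \<open>Charging a conditional for its more expensive branch makes the count independent of the
  memory, so that \<open>simp\<close> evaluates it to a numeral.\<close>

fun steps :: "com \<Rightarrow> nat" where
  "steps (Seq c1 c2) = steps c1 + steps c2"
| "steps (IfLess a b c1 c2) = 1 + max (steps c1) (steps c2)"
| "steps _ = 1"

text \<open>Loops are left to \<open>triple_for\<close> below.\<close>

fun wp :: "nat \<Rightarrow> nat list \<Rightarrow> com \<Rightarrow> (memory \<Rightarrow> nat list \<Rightarrow> bool) \<Rightarrow> memory \<Rightarrow> nat list \<Rightarrow> bool" where
  "wp b x Skip Q s y \<longleftrightarrow> Q s y"
| "wp b x (Assign r f a a') Q s y \<longleftrightarrow>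
     arith_val f (operand_val x s a) (operand_val x s a') < 2 ^ b \<and>
     Q (s(r := arith_val f (operand_val x s a) (operand_val x s a'))) y"
| "wp b x (Store r a) Q s y \<longleftrightarrow> Q (s(s r := operand_val x s a)) y"
| "wp b x (Write a) Q s y \<longleftrightarrow> Q s (y @ [operand_val x s a])"
| "wp b x (Seq c1 c2) Q s y \<longleftrightarrow> wp b x c1 (wp b x c2 Q) s y"
| "wp b x (IfLess a a' c1 c2) Q s y \<longleftrightarrow>
     (if operand_val x s a < operand_val x s a' then wp b x c1 Q s y else wp b x c2 Q s y)"
| "wp b x (WhileLess a a' c) Q s y \<longleftrightarrow> False"

locale bounded_ram =
  fixes x :: "nat list" and b :: nat
  assumes b: "5 \<le> b" and input_bound: "input_cell x i < 2 ^ b"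
begin

definition bounded :: "memory \<Rightarrow> bool" where
  "bounded s \<longleftrightarrow> (\<forall>a. s a < 2 ^ b)"

text \<open>
  \<open>T\<close> counts instructions and tests. Each of them accesses at most seven addresses and values, all
  of bit length at most \<open>b\<close>.
\<close>

definition triple ::
  "(memory \<Rightarrow> nat list \<Rightarrow> bool) \<Rightarrow> com \<Rightarrow> nat \<Rightarrow> (memory \<Rightarrow> nat list \<Rightarrow> bool) \<Rightarrow> bool" where
  "triple P c T Q \<longleftrightarrow> (\<forall>s y. P s y \<longrightarrow> bounded s \<longrightarrow>
     (\<exists>t s' y'. exec x c (s, y) t (s', y') \<and> t \<le> 7 * b * T \<and> bounded s' \<and> Q s' y'))"

lemma small_less: "k < (32 :: nat) \<Longrightarrow> k < 2 ^ b"
proof -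
  have "(2::nat) ^ 5 \<le> 2 ^ b" using b by (intro power_increasing) auto
  then show "k < 32 \<Longrightarrow> k < 2 ^ b" by simp
qed

lemma bit_length_le: "v < 2 ^ b \<Longrightarrow> bit_length v \<le> b"
  using b by (intro bit_length_leI) auto

lemma operand_bounds:
  assumes "small_operand a" "bounded s"
  shows "operand_val x s a < 2 ^ b" "operand_cost x s a \<le> 3 * b"
proof -
  show "operand_val x s a < 2 ^ b"
    using assms input_bound by (cases a) (auto simp: bounded_def small_less)
  have *: "bit_length r \<le> b" if "r < 32" for r
    using that small_less bit_length_le by blast
  have s: "bit_length (s r) \<le> b" for r
    using assms(2) bit_length_le by (auto simp: bounded_def)
  have i: "bit_length (input_cell x r) \<le> b" for r
    using input_bound bit_length_le by blast
  show "operand_cost x s a \<le> 3 * b"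
  proof (cases a)
    case (Const k)
    then show ?thesis using * assms by force
  next
    case (Reg r)
    then show ?thesis using *[of r] s[of r] assms(1) by simp
  next
    case (Ind r)
    then show ?thesis using *[of r] s[of r] s[of "s r"] assms(1) by simp
  next
    case (Inp r)
    then show ?thesis using *[of r] s[of r] i[of "s r"] assms(1) by simp
  qed
qed

lemma wp_sound:
  assumes "wp b x c Q s y" "small_com c" "bounded s"
  shows "\<exists>t s' y'. exec x c (s, y) t (s', y') \<and> t \<le> 7 * b * steps c \<and> bounded s' \<and> Q s' y'"
  using assms
proof (induction c arbitrary: Q s y)
  case Skip
  then show ?case using exec.Skip[of x s y] b by fastforce
next
  case (Assign r f a a')
  have "bit_length r \<le> b"
    using Assign.prems(2) small_less bit_length_le by simp
  moreover have "operand_cost x s a \<le> 3 * b" "operand_cost x s a' \<le> 3 * b"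
    using Assign.prems operand_bounds by auto
  moreover have "bounded (s(r := arith_val f (operand_val x s a) (operand_val x s a')))"
    using Assign.prems by (auto simp: bounded_def)
  ultimately show ?case
    using exec.Assign[of x r f a a' s y] Assign.prems
    by - (intro exI conjI, assumption, auto simp del: fun_upd_apply simp: fun_upd_def[symmetric])
next
  case (Store r a)
  have "bit_length r \<le> b" "bit_length (s r) \<le> b"
    using Store.prems small_less bit_length_le by (auto simp: bounded_def)
  moreover have "operand_cost x s a \<le> 3 * b" "operand_val x s a < 2 ^ b"
    using Store.prems operand_bounds by auto
  \<comment> \<open>A stored value is an operand and hence already bounded; this is why
    \<open>wp\<close> has an overflow condition only for \<open>Assign\<close>.\<close>
  moreover from this have "bounded (s(s r := operand_val x s a))"
    using Store.prems by (simp add: bounded_def)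
  ultimately show ?case
    using exec.Store[of x r a s y] Store.prems
    by - (intro exI conjI, assumption, auto simp del: fun_upd_apply simp: fun_upd_def[symmetric])
next
  case (Write a)
  have "operand_cost x s a \<le> 3 * b"
    using Write.prems operand_bounds by auto
  then show ?case
    using exec.Write[of x a s y] Write.prems
    by - (intro exI conjI, assumption, auto)
next
  case (Seq c1 c2)
  from Seq.prems obtain t s' y' where 1: "exec x c1 (s, y) t (s', y')" "t \<le> 7 * b * steps c1"
    "bounded s'" "wp b x c2 Q s' y'"
    using Seq.IH(1)[of "wp b x c2 Q" s y] by auto
  with Seq.prems obtain t2 s'' y'' where 2: "exec x c2 (s', y') t2 (s'', y'')"
    "t2 \<le> 7 * b * steps c2" "bounded s''" "Q s'' y''"
    using Seq.IH(2)[of Q s' y'] by auto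
  from exec.Seq[OF 1(1) 2(1)] 1 2 show ?case
    by - (intro exI conjI, assumption, auto simp: algebra_simps)
next
  case (IfLess a a' c1 c2)
  have c: "operand_cost x s a \<le> 3 * b" "operand_cost x s a' \<le> 3 * b"
    using IfLess.prems operand_bounds by auto
  let ?d = "if operand_val x s a < operand_val x s a' then c1 else c2"
  obtain t s' y' where 1: "exec x ?d (s, y) t (s', y')" "t \<le> 7 * b * steps ?d" "bounded s'" "Q s' y'"
    using IfLess.IH(1)[of Q s y] IfLess.IH(2)[of Q s y] IfLess.prems by (auto split: if_splits)
  have "7 * b * steps ?d \<le> 7 * b * max (steps c1) (steps c2)"
    by (intro mult_le_mono2) simp
  with 1 have t: "t \<le> 7 * b * max (steps c1) (steps c2)" by linarith
  have "exec x (IfLess a a' c1 c2) (s, y) (operand_cost x s a + operand_cost x s a' + t) (s', y')"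
    using 1(1) by (auto intro: exec.IfTrue exec.IfFalse split: if_splits)
  then show ?case
    using t 1(3,4) c by - (intro exI conjI, assumption, auto simp: algebra_simps)
qed simp

lemma triple_wp:
  assumes "\<And>s y. P s y \<Longrightarrow> wp b x c Q s y" "small_com c"
  shows "triple P c (steps c) Q"
  unfolding triple_def by (intro allI impI wp_sound assms)

lemma triple_seq:
  assumes "triple P c1 T1 Q" "triple Q c2 T2 R"
  shows "triple P (Seq c1 c2) (T1 + T2) R"
  unfolding triple_def
proof (intro allI impI)
  fix s y assume "P s y" "bounded s"
  with assms(1) obtain t s' y' where 1: "exec x c1 (s, y) t (s', y')" "t \<le> 7 * b * T1"
    "bounded s'" "Q s' y'" unfolding triple_def by blast
  with assms(2) obtain t2 s'' y'' where 2: "exec x c2 (s', y') t2 (s'', y'')" "t2 \<le> 7 * b * T2"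
    "bounded s''" "R s'' y''" unfolding triple_def by blast
  from exec.Seq[OF 1(1) 2(1)] 1 2
  show "\<exists>t s' y'. exec x (Seq c1 c2) (s, y) t (s', y') \<and> t \<le> 7 * b * (T1 + T2) \<and> bounded s' \<and> R s' y'"
    by - (intro exI conjI, assumption, auto simp: algebra_simps)
qed

text \<open>Serves conditionals with a loop in a branch, such as the call of \<open>cover\<close> in
  \<open>select_body\<close>, which \<open>wp\<close> cannot treat.\<close>

lemma triple_if:
  assumes 1: "triple (\<lambda>s y. P s y \<and> operand_val x s a < operand_val x s a') c1 T Q"
    and 2: "triple (\<lambda>s y. P s y \<and> \<not> operand_val x s a < operand_val x s a') c2 T Q"
    and small: "small_operand a" "small_operand a'"
  shows "triple P (IfLess a a' c1 c2) (T + 1) Q"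
  unfolding triple_def
proof (intro allI impI)
  fix s y assume P: "P s y" and s: "bounded s"
  have c: "operand_cost x s a \<le> 3 * b" "operand_cost x s a' \<le> 3 * b"
    using small s operand_bounds by auto
  let ?d = "if operand_val x s a < operand_val x s a' then c1 else c2"
  obtain t s' y' where d: "exec x ?d (s, y) t (s', y')" "t \<le> 7 * b * T" "bounded s'" "Q s' y'"
    using 1 2 P s unfolding triple_def by (cases "operand_val x s a < operand_val x s a'") (simp, blast)+
  have "exec x (IfLess a a' c1 c2) (s, y) (operand_cost x s a + operand_cost x s a' + t) (s', y')"
    using d(1) by (auto intro: exec.IfTrue exec.IfFalse split: if_splits)
  then show "\<exists>t s' y'. exec x (IfLess a a' c1 c2) (s, y) t (s', y') \<and> t \<le> 7 * b * (T + 1) \<and>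
      bounded s' \<and> Q s' y'"
    using d c by - (intro exI conjI, assumption, auto simp: algebra_simps)
qed

lemma triple_conseq:
  assumes "triple P c T Q" "\<And>s y. P' s y \<Longrightarrow> P s y" "\<And>s y. Q s y \<Longrightarrow> Q' s y" "T \<le> T'"
  shows "triple P' c T' Q'"
  unfolding triple_def
proof (intro allI impI)
  fix s y assume "P' s y" "bounded s"
  with assms(1,2) obtain t s' y' where 1: "exec x c (s, y) t (s', y')" "t \<le> 7 * b * T"
    "bounded s'" "Q s' y'" unfolding triple_def by blast
  have "7 * b * T \<le> 7 * b * T'" using assms(4) by (intro mult_le_mono2)
  with 1 assms(3) show "\<exists>t s' y'. exec x c (s, y) t (s', y') \<and> t \<le> 7 * b * T' \<and> bounded s' \<and> Q' s' y'"
    by (meson order_trans)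
qed

text \<open>Fixes a ghost variable of the precondition; here it is the current cover, which the loop
  invariants only assert to exist.\<close>

lemma triple_ex: "(\<And>z. triple (P z) c T Q) \<Longrightarrow> triple (\<lambda>s y. \<exists>z. P z s y) c T Q"
  unfolding triple_def
proof (intro allI impI, elim exE)
  fix s y z
  assume *: "\<And>z. \<forall>s y. P z s y \<longrightarrow> bounded s \<longrightarrow>
      (\<exists>t s' y'. exec x c (s, y) t (s', y') \<and> t \<le> 7 * b * T \<and> bounded s' \<and> Q s' y')"
    and "bounded s" "P z s y"
  with *[rule_format, of z s y]
  show "\<exists>t s' y'. exec x c (s, y) t (s', y') \<and> t \<le> 7 * b * T \<and> bounded s' \<and> Q s' y'" by simp
qed

text \<open>The invariant pins both the counter and the limit, so \<open>i\<close> alone decides the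
  test. Each round is charged one test, and the last \<open>+ 1\<close> pays for the test that
  fails.\<close>

lemma triple_for:
  assumes body: "\<And>i. i < n \<Longrightarrow> triple (Inv i) c T (Inv (Suc i))"
    and cnt: "\<And>i s y. Inv i s y \<Longrightarrow> s r = i \<and> s l = n"
    and small: "r < 32" "l < 32"
  shows "triple (Inv 0) (WhileLess (Reg r) (Reg l) c) (n * (T + 1) + 1) (Inv n)"
proof -
  let ?w = "WhileLess (Reg r) (Reg l) c"
  \<comment> \<open>The induction is on the number of rounds still to run, because
    \<open>WhileTrue\<close> unfolds a loop at its front.\<close>
  have *: "triple (Inv (n - k)) ?w (k * (T + 1) + 1) (Inv n)" if "k \<le> n" for k
    using that
  proof (induction k)
    case 0
    show ?case unfolding triple_def
    proof (intro allI impI)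
      fix s y assume i: "Inv (n - 0) s y" and s: "bounded s"
      have "operand_cost x s (Reg r) \<le> 3 * b" "operand_cost x s (Reg l) \<le> 3 * b"
        using small s operand_bounds(2)[of "Reg r" s] operand_bounds(2)[of "Reg l" s] by auto
      then show "\<exists>t s' y'. exec x ?w (s, y) t (s', y') \<and> t \<le> 7 * b * (0 * (T + 1) + 1) \<and>
          bounded s' \<and> Inv n s' y'"
        using i s cnt[OF i] exec.WhileFalse[of x s "Reg r" "Reg l" c y]
        by (intro exI[of _ "operand_cost x s (Reg r) + operand_cost x s (Reg l)"] exI[of _ s] exI[of _ y])
           (simp del: operand_cost.simps)
    qed
  next
    case (Suc k)
    show ?case unfolding triple_def
    proof (intro allI impI)
      fix s y assume i: "Inv (n - Suc k) s y" and s: "bounded s"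
      have c: "operand_cost x s (Reg r) \<le> 3 * b" "operand_cost x s (Reg l) \<le> 3 * b"
        using small s operand_bounds(2)[of "Reg r" s] operand_bounds(2)[of "Reg l" s] by auto
      have lt: "operand_val x s (Reg r) < operand_val x s (Reg l)"
        using cnt[OF i] Suc.prems by simp
      have "Suc (n - Suc k) = n - k" using Suc.prems by simp
      then have "triple (Inv (n - Suc k)) c T (Inv (n - k))"
        using body[of "n - Suc k"] Suc.prems by simp
      with i s obtain t s' y' where 1: "exec x c (s, y) t (s', y')"
        "t \<le> 7 * b * T" "bounded s'" "Inv (n - k) s' y'"
        unfolding triple_def by blast
      with Suc.IH Suc.prems obtain t2 s'' y'' where 2: "exec x ?w (s', y') t2 (s'', y'')"
        "t2 \<le> 7 * b * (k * (T + 1) + 1)" "bounded s''" "Inv n s'' y''"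
        unfolding triple_def by (meson Suc_leD)
      from exec.WhileTrue[OF lt 1(1) 2(1)] c 1 2
      show "\<exists>t s' y'. exec x ?w (s, y) t (s', y') \<and> t \<le> 7 * b * (Suc k * (T + 1) + 1) \<and>
          bounded s' \<and> Inv n s' y'"
        by - (intro exI conjI, assumption, auto simp: algebra_simps simp del: operand_cost.simps)
    qed
  qed
  from *[of n] show ?thesis by simp
qed

end

text \<open>Cell 0 holds the length of the input, which fits because every entry has bit length at
  least 1. The 5 is the lower bound that \<open>bounded_ram\<close> demands.\<close>

lemma input_cell_less: "input_cell x i < 2 ^ (input_size x + 5)"
proof -
  have "v < 2 ^ (input_size x + 5)" if "v \<in> set x" for v
  proof -
    have "bit_length v \<le> input_size x"
      using that unfolding input_size_def by (intro member_le_sum_list) auto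
    then have "(2::nat) ^ bit_length v \<le> 2 ^ (input_size x + 5)"
      by (intro power_increasing) auto
    then show ?thesis using less_two_power_bit_length[of v] by linarith
  qed
  moreover have "length x \<le> input_size x"
    unfolding input_size_def by (induction x) (auto simp: bit_length_def)
  then have "length x < 2 ^ (input_size x + 5)"
    by (meson less_exp le_add1 order.strict_trans1 order_trans)
  ultimately show ?thesis
    unfolding input_cell_def by (auto simp: nth_Cons split: nat.split)
qed

section \<open>Greedy covers of laminar families\<close>

text \<open>Layer cake: \<open>f\<close> is a nonnegative combination of the indicators of its level sets.\<close>

lemma sum_mult_le_level_sets:
  fixes w f :: "'a \<Rightarrow> real"
  assumes "finite A" "\<And>a. a \<in> A \<Longrightarrow> 0 \<le> f a" "\<And>a. a \<in> A \<Longrightarrow> f a \<le> c" "0 \<le> c" "0 \<le> B"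
    and "\<And>t. 0 < t \<Longrightarrow> (\<Sum>a | a \<in> A \<and> t \<le> f a. w a) \<le> B"
  shows "(\<Sum>a\<in>A. w a * f a) \<le> c * B"
  using assms
proof (induction "card {a \<in> A. 0 < f a}" arbitrary: f c rule: less_induct)
  case less
  let ?S = "{a \<in> A. 0 < f a}"
  have fin: "finite ?S" using less.prems(1) by simp
  show ?case
  proof (cases "?S = {}")
    case True
    then have "w a * f a = 0" if "a \<in> A" for a
      using that less.prems(2)[of a] by fastforce
    then have "(\<Sum>a\<in>A. w a * f a) = 0" by (intro sum.neutral) blast
    then show ?thesis using less.prems(4,5) by simp
  next
    case False
    \<comment> \<open>The lowest layer, of height \<open>m\<close>, is peeled off. What remains is
      \<open>g\<close>, whose support has lost \<open>a0\<close> and whose level set at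
      \<open>t\<close> is that of \<open>f\<close> at \<open>t + m\<close>.\<close>
    define m where "m = Min (f ` ?S)"
    have "m \<in> f ` ?S" unfolding m_def using False fin by (intro Min_in) auto
    then obtain a0 where a0: "a0 \<in> A" "f a0 = m" "0 < m" by auto
    have m_le: "m \<le> f a" if "a \<in> A" "0 < f a" for a
      unfolding m_def using fin that by (intro Min_le) auto
    define g where "g a = (if 0 < f a then f a - m else 0)" for a
    have "{a \<in> A. 0 < g a} \<subseteq> ?S" by (auto simp: g_def split: if_splits)
    moreover have "a0 \<in> ?S" "a0 \<notin> {a \<in> A. 0 < g a}" using a0 by (simp_all add: g_def)
    ultimately have "{a \<in> A. 0 < g a} \<subset> ?S" by blast
    then have card: "card {a \<in> A. 0 < g a} < card ?S"
      using fin by (intro psubset_card_mono)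
    have level: "(\<Sum>a | a \<in> A \<and> t \<le> g a. w a) \<le> B" if "0 < t" for t
    proof -
      have "{a. a \<in> A \<and> t \<le> g a} = {a. a \<in> A \<and> t + m \<le> f a}"
        using that a0(3) by (auto simp: g_def)
      with less.prems(6)[of "t + m"] that a0(3) show ?thesis by simp
    qed
    have "(\<Sum>a\<in>A. w a * g a) \<le> (c - m) * B"
    proof (rule less.hyps[OF card])
      show "g a \<le> c - m" if "a \<in> A" for a
        using that less.prems(3)[of a] less.prems(3)[of a0] a0 by (auto simp: g_def)
      show "0 \<le> c - m" using less.prems(3)[of a0] a0 by simp
      show "0 \<le> g a" if "a \<in> A" for a
        using that m_le[of a] by (simp add: g_def)
    qed (use less.prems(1,5) level in simp_all)
    moreover have "(\<Sum>a\<in>A. w a * f a) = (\<Sum>a\<in>A. w a * g a) + m * (\<Sum>a\<in>?S. w a)"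
    proof -
      have "(\<Sum>a\<in>A. w a * f a) = (\<Sum>a\<in>A. w a * g a + (if 0 < f a then m * w a else 0))"
      proof (rule sum.cong)
        fix a assume "a \<in> A"
        then show "w a * f a = w a * g a + (if 0 < f a then m * w a else 0)"
          using less.prems(2)[of a] by (auto simp: g_def algebra_simps)
      qed simp
      also have "\<dots> = (\<Sum>a\<in>A. w a * g a) + m * (\<Sum>a\<in>?S. w a)"
        using less.prems(1) by (simp add: sum.distrib sum.inter_filter[symmetric] sum_distrib_left)
      finally show ?thesis .
    qed
    moreover have "{a \<in> A. m \<le> f a} = ?S" using m_le a0(3) by auto
    then have "(\<Sum>a\<in>?S. w a) \<le> B" using less.prems(6)[OF a0(3)] by simp
    then have "m * (\<Sum>a\<in>?S. w a) \<le> m * B" using a0(3) by simp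
    ultimately show ?thesis by (simp add: algebra_simps)
  qed
qed

text \<open>Optimality is a property of the covered set, not of a selection of signals: many
  selections have the same union, and the machine only stores flags of states.\<close>

definition best_cover :: "('s \<Rightarrow> real) \<Rightarrow> ('g \<Rightarrow> 's set) \<Rightarrow> 'g set \<Rightarrow> 's set \<Rightarrow> bool" where
  "best_cover w N P C \<longleftrightarrow> (\<exists>S\<subseteq>P. C = \<Union>(N ` S)) \<and> (\<forall>S\<subseteq>P. sum w (\<Union>(N ` S)) \<le> sum w C)"

text \<open>
  The competitor containing \<open>N j\<close> is compared with the one in which \<open>N j\<close> is replaced by
  \<open>C \<inter> N j\<close>, which by laminarity is again a union of neighbourhoods of signals in \<open>P\<close>.
\<close>

lemma best_cover_insert:
  assumes best: "best_cover w N P C"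
    and fin: "finite A" "\<And>i. i \<in> insert j P \<Longrightarrow> N i \<subseteq> A"
    and lam: "\<And>i. i \<in> P \<Longrightarrow> N i \<subseteq> N j \<or> N i \<inter> N j = {}"
  shows "best_cover w N (insert j P) (if 0 < sum w (N j - C) then C \<union> N j else C)"
    (is "best_cover _ _ _ ?C")
proof -
  from best obtain S0 where S0: "S0 \<subseteq> P" "C = \<Union>(N ` S0)" by (auto simp: best_cover_def)
  have finN: "finite X" if "X \<subseteq> A" for X using that fin(1) finite_subset by blast
  have CA: "C \<subseteq> A" "N j \<subseteq> A" using S0 fin(2) by blast+
  \<comment> \<open>The greedy rule gains exactly the positive part of the weight of
    \<open>N j - C\<close>; every competitor is compared with this form.\<close>
  have wC: "sum w ?C = sum w C + max 0 (sum w (N j - C))"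
    using sum.union_disjoint[of C "N j - C" w] finN CA
    by (auto simp: Un_Diff_cancel)
  have "\<exists>S\<subseteq>insert j P. ?C = \<Union>(N ` S)"
    using S0 by (intro exI[of _ "if 0 < sum w (N j - C) then insert j S0 else S0"]) auto
  moreover have "sum w (\<Union>(N ` S)) \<le> sum w ?C" if S: "S \<subseteq> insert j P" for S
  proof (cases "j \<in> S")
    case False
    then have "sum w (\<Union>(N ` S)) \<le> sum w C" using S best by (auto simp: best_cover_def)
    then show ?thesis unfolding wC by simp
  next
    case True
    \<comment> \<open>By laminarity \<open>N j\<close> absorbs all of the competitor except
      \<open>S1\<close>. Likewise \<open>S2\<close> picks the part of the selection behind
      \<open>C\<close> that makes up \<open>C \<inter> N j\<close>.\<close>
    define S1 where "S1 = {i \<in> S. i \<in> P \<and> N i \<inter> N j = {}}"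
    define S2 where "S2 = {i \<in> S0. N i \<subseteq> N j}"
    let ?U = "\<Union>(N ` S1)"
    have US: "\<Union>(N ` S) = ?U \<union> N j" "?U \<inter> N j = {}"
      unfolding S1_def using S True lam by blast+
    have CS: "C \<inter> N j = \<Union>(N ` S2)"
      unfolding S2_def using S0 lam by blast
    have UA: "?U \<subseteq> A" unfolding S1_def using fin(2) by blast
    \<comment> \<open>This selection avoids \<open>j\<close>, so the optimality of \<open>C\<close>
      applies; exchanging \<open>C \<inter> N j\<close> for \<open>N j\<close> then changes the
      weight by that of \<open>N j - C\<close>.\<close>
    have "sum w (\<Union>(N ` (S1 \<union> S2))) \<le> sum w C"
    proof -
      have "S1 \<union> S2 \<subseteq> P" using S0 by (auto simp: S1_def S2_def)
      then show ?thesis using best unfolding best_cover_def by blast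
    qed
    moreover have "\<Union>(N ` (S1 \<union> S2)) = ?U \<union> (C \<inter> N j)" using CS by auto
    moreover have "sum w (?U \<union> (C \<inter> N j)) = sum w ?U + sum w (C \<inter> N j)"
      using US(2) UA CA finN by (intro sum.union_disjoint) auto
    moreover have "sum w (\<Union>(N ` S)) = sum w ?U + sum w (N j)"
      unfolding US(1) using US(2) UA CA finN by (intro sum.union_disjoint) auto
    moreover have "sum w (N j) = sum w (C \<inter> N j) + sum w (N j - C)"
      using sum.Int_Diff[OF finN[OF CA(2)], of w C] by (simp add: Int_commute)
    ultimately show ?thesis unfolding wC by simp
  qed
  ultimately show ?thesis by (auto simp: best_cover_def)
qed

definition weight :: "('s, 'g) delegation \<Rightarrow> 's \<Rightarrow> real" where
  "weight I \<theta> = (if \<theta> \<in> acceptable I then of_rat (prob I \<theta>) else - of_rat (prob I \<theta>))"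

text \<open>Up to a constant the utility becomes a weighted sum of maxima, the form to which
  \<open>sum_mult_le_level_sets\<close> applies.\<close>

lemma receiver_utility_eq:
  assumes "delegation_instance I"
  shows "receiver_utility I \<psi> =
    (\<Sum>\<theta>\<in>rejectable I. of_rat (prob I \<theta>)) + (\<Sum>\<theta>\<in>states I. weight I \<theta> * Max (\<psi> ` nbrs_state I \<theta>))"
proof -
  have fin: "finite (acceptable I)" "finite (rejectable I)" and disj: "acceptable I \<inter> rejectable I = {}"
    using assms by (auto simp: delegation_instance_def states_def)
  let ?f = "\<lambda>\<theta>. weight I \<theta> * Max (\<psi> ` nbrs_state I \<theta>)"
  have "sum ?f (states I) = sum ?f (acceptable I) + sum ?f (rejectable I)"
    unfolding states_def by (intro sum.union_disjoint fin disj)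
  also have "sum ?f (acceptable I) = (\<Sum>\<theta>\<in>acceptable I. of_rat (prob I \<theta>) * Max (\<psi> ` nbrs_state I \<theta>))"
    by (simp add: weight_def)
  also have "sum ?f (rejectable I) = (\<Sum>\<theta>\<in>rejectable I. - (of_rat (prob I \<theta>) * Max (\<psi> ` nbrs_state I \<theta>)))"
    using disj by (intro sum.cong) (auto simp: weight_def)
  finally show ?thesis
    by (simp add: receiver_utility_def algebra_simps sum_subtractf sum_negf)
qed

text \<open>Since \<open>C\<close> is a union of neighbourhoods, the states with an accepted signal
  are exactly those of \<open>C\<close>. For any scheme \<open>\<phi>\<close>, the states whose
  maximum reaches \<open>t\<close> are the union of the neighbourhoods of the signals with value at
  least \<open>t\<close>, so no level set outweighs \<open>C\<close>.\<close>

lemma optimal_scheme_best_cover: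
  assumes inst: "delegation_instance I"
    and best: "best_cover (weight I) (nbrs_signal I) (signals I) C"
  shows "optimal_scheme I (\<lambda>\<sigma>. if nbrs_signal I \<sigma> \<subseteq> C then 1 else 0)"
proof -
  let ?\<chi> = "\<lambda>\<sigma>. if nbrs_signal I \<sigma> \<subseteq> C then 1 else 0 :: real"
  let ?N = "nbrs_state I" and ?M = "nbrs_signal I"
  have fin: "finite (states I)" "finite (signals I)" and E: "edges I \<subseteq> states I \<times> signals I"
    and ne: "\<And>\<theta>. \<theta> \<in> states I \<Longrightarrow> ?N \<theta> \<noteq> {}"
    using inst by (auto simp: delegation_instance_def)
  have N_sub: "?N \<theta> \<subseteq> signals I" for \<theta> using E by (auto simp: nbrs_state_def)
  have finN: "finite (?N \<theta>)" for \<theta> using N_sub fin(2) finite_subset by blast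
  from best obtain S0 where S0: "S0 \<subseteq> signals I" "C = \<Union>(?M ` S0)" by (auto simp: best_cover_def)
  have CA: "C \<subseteq> states I" using S0 E by (auto simp: nbrs_signal_def)
  have Max_\<chi>: "Max (?\<chi> ` ?N \<theta>) = (if \<theta> \<in> C then 1 else 0)" if \<theta>: "\<theta> \<in> states I" for \<theta>
  proof (cases "\<theta> \<in> C")
    case True
    then obtain \<sigma> where "\<sigma> \<in> S0" "\<theta> \<in> ?M \<sigma>" using S0 by auto
    then have "\<sigma> \<in> ?N \<theta>" "?M \<sigma> \<subseteq> C" using S0 by (auto simp: nbrs_state_def nbrs_signal_def)
    then have "Max (?\<chi> ` ?N \<theta>) = 1"
      using finN by (intro Max_eqI) (auto simp: image_iff)
    then show ?thesis using True by simp
  next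
    case False
    then have "?\<chi> ` ?N \<theta> = {0}"
      using ne[OF \<theta>] by (force simp: nbrs_state_def nbrs_signal_def)
    then show ?thesis using False by simp
  qed
  have U\<chi>: "receiver_utility I ?\<chi> = (\<Sum>\<theta>\<in>rejectable I. of_rat (prob I \<theta>)) + sum (weight I) C"
  proof -
    have "(\<Sum>\<theta>\<in>states I. weight I \<theta> * Max (?\<chi> ` ?N \<theta>)) = (\<Sum>\<theta>\<in>states I. if \<theta> \<in> C then weight I \<theta> else 0)"
      by (intro sum.cong) (simp_all only: Max_\<chi> if_distrib[of "(*) _"] mult_1_right mult_zero_right)
    also have "\<dots> = sum (weight I) C"
      using fin CA by (simp add: sum.If_cases Int_absorb1)
    finally show ?thesis unfolding receiver_utility_eq[OF inst] by simp
  qed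
  have "receiver_utility I \<phi> \<le> receiver_utility I ?\<chi>" if \<phi>: "\<phi> \<in> decision_schemes I" for \<phi>
  proof -
    have \<phi>01: "0 \<le> \<phi> \<sigma>" "\<phi> \<sigma> \<le> 1" if "\<sigma> \<in> signals I" for \<sigma>
      using \<phi> that by (auto simp: decision_schemes_def)
    have "(\<Sum>\<theta>\<in>states I. weight I \<theta> * Max (\<phi> ` ?N \<theta>)) \<le> 1 * sum (weight I) C"
    proof (rule sum_mult_le_level_sets[OF fin(1)])
      fix \<theta> assume \<theta>: "\<theta> \<in> states I"
      have "Max (\<phi> ` ?N \<theta>) \<in> \<phi> ` ?N \<theta>" using finN ne[OF \<theta>] by (intro Max_in) auto
      then show "0 \<le> Max (\<phi> ` ?N \<theta>)" "Max (\<phi> ` ?N \<theta>) \<le> 1"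
        using \<phi>01 N_sub[of \<theta>] by fastforce+
    next
      have "sum (weight I) (\<Union>(?M ` {})) \<le> sum (weight I) C"
        using best unfolding best_cover_def by blast
      then show "0 \<le> sum (weight I) C" by simp
    next
      fix t :: real
      have "{\<theta>. \<theta> \<in> states I \<and> t \<le> Max (\<phi> ` ?N \<theta>)} = \<Union>(?M ` {\<sigma> \<in> signals I. t \<le> \<phi> \<sigma>})"
        (is "?L = ?R")
      proof -
        have "(t \<le> Max (\<phi> ` ?N \<theta>)) \<longleftrightarrow> (\<exists>\<sigma>\<in>?N \<theta>. t \<le> \<phi> \<sigma>)" if "\<theta> \<in> states I" for \<theta>
          using Max_ge_iff[of "\<phi> ` ?N \<theta>" t] finN ne[OF that] by auto
        then have "?L = {\<theta> \<in> states I. \<exists>\<sigma>\<in>?N \<theta>. t \<le> \<phi> \<sigma>}" by blast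
        also have "\<dots> = ?R"
        proof -
          have "\<sigma> \<in> ?N \<theta> \<longleftrightarrow> \<sigma> \<in> signals I \<and> \<theta> \<in> states I \<and> \<theta> \<in> ?M \<sigma>" for \<theta> \<sigma>
            using E by (auto simp: nbrs_state_def nbrs_signal_def)
          moreover have "\<theta> \<in> ?M \<sigma> \<Longrightarrow> \<theta> \<in> states I" for \<theta> \<sigma>
            using E by (auto simp: nbrs_signal_def)
          ultimately show ?thesis by blast
        qed
        finally show ?thesis .
      qed
      then show "(\<Sum>\<theta> | \<theta> \<in> states I \<and> t \<le> Max (\<phi> ` ?N \<theta>). weight I \<theta>) \<le> sum (weight I) C"
        using best unfolding best_cover_def by auto
    qed simp
    then show ?thesis unfolding U\<chi> unfolding receiver_utility_eq[OF inst] by simp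
  qed
  moreover have "?\<chi> \<in> decision_schemes I" by (auto simp: decision_schemes_def)
  ultimately show ?thesis
    unfolding optimal_scheme_def is_arg_max_def by (blast dest: leD)
qed

section \<open>The program and its correctness\<close>

lemma nth_concat_map_uniform:
  assumes "\<And>a. a \<in> set xs \<Longrightarrow> length (f a) = k" "i < length xs" "j < k"
  shows "concat (map f xs) ! (i * k + j) = f (xs ! i) ! j"
  using assms
proof (induction xs arbitrary: i)
  case (Cons a xs)
  show ?case
  proof (cases i)
    case 0
    then show ?thesis using Cons.prems by (simp add: nth_append)
  next
    case (Suc i')
    then show ?thesis using Cons by (simp add: nth_append)
  qed
qed simp

lemma length_concat_map_uniform:
  "(\<And>a. a \<in> set xs \<Longrightarrow> length (f a) = k) \<Longrightarrow> length (concat (map f xs)) = length xs * k"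
  by (induction xs) auto

section \<open>The program\<close>

fun block :: "com list \<Rightarrow> com" where
  "block [] = Skip"
| "block (c # cs) = Seq c (block cs)"

text \<open>The flags of the covered states start at cell \<open>covered\<close>.\<close>

abbreviation (input) "cN \<equiv> 2 :: nat"
abbreviation (input) "cM \<equiv> 3 :: nat"
abbreviation (input) "cOff \<equiv> 4 :: nat"
abbreviation (input) "cJ \<equiv> 5 :: nat"
abbreviation (input) "cSize \<equiv> 6 :: nat"
abbreviation (input) "cI \<equiv> 7 :: nat"
abbreviation (input) "cDeg \<equiv> 8 :: nat"
abbreviation (input) "cAcc \<equiv> 9 :: nat"
abbreviation (input) "cRej \<equiv> 10 :: nat"
abbreviation (input) "cDen \<equiv> 11 :: nat"
abbreviation (input) "cAddr \<equiv> 12 :: nat"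
abbreviation (input) "cQNum \<equiv> 13 :: nat"
abbreviation (input) "cQDen \<equiv> 14 :: nat"
abbreviation (input) "covered \<equiv> 16 :: nat"

abbreviation move :: "nat \<Rightarrow> operand \<Rightarrow> com" where
  "move r a \<equiv> Assign r Add a (Const 0)"

text \<open>The incidence matrix is stored by rows, one for each state. Before it come cells 0 to 2,
  \<open>n\<close> flags and \<open>2 * n\<close> entries for the probabilities, so
  \<open>cOff\<close> will be \<open>3 + 3 * n\<close>.\<close>

definition edge_address :: com where
  "edge_address = block
     [Assign cAddr Mul (Reg cI) (Reg cM),
      Assign cAddr Add (Reg cAddr) (Reg cJ),
      Assign cAddr Add (Reg cAddr) (Reg cOff)]"

text \<open>
  Adds the probability of an uncovered neighbour to one of the fractions \<open>cAcc / cDen\<close> and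
  \<open>cRej / cDen\<close>.
\<close>

definition add_prob :: com where
  "add_prob = block
     [Assign cAddr Add (Reg cI) (Reg cI),
      Assign cAddr Add (Reg cAddr) (Reg cN),
      Assign cAddr Add (Reg cAddr) (Const 3),
      move cQNum (Inp cAddr),
      Assign cAddr Add (Reg cAddr) (Const 1),
      move cQDen (Inp cAddr),
      Assign cQNum Mul (Reg cQNum) (Reg cDen),
      Assign cAcc Mul (Reg cAcc) (Reg cQDen),
      Assign cRej Mul (Reg cRej) (Reg cQDen),
      Assign cDen Mul (Reg cDen) (Reg cQDen),
      Assign cAddr Add (Reg cI) (Const 3),
      IfLess (Const 0) (Inp cAddr)
        (Assign cAcc Add (Reg cAcc) (Reg cQNum))
        (Assign cRej Add (Reg cRej) (Reg cQNum))]"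

text \<open>The degree counts all neighbours but the fractions only uncovered ones; one kind of pass
  thus serves the size test, the gain test and the output.\<close>

definition scan_body :: com where
  "scan_body = block
     [edge_address,
      IfLess (Const 0) (Inp cAddr)
        (block
          [Assign cDeg Add (Reg cDeg) (Const 1),
           Assign cAddr Add (Reg cI) (Const covered),
           IfLess (Const 0) (Ind cAddr) Skip add_prob])
        Skip,
      Assign cI Add (Reg cI) (Const 1)]"

definition scan_init :: com where
  "scan_init = block
     [move cI (Const 0), move cDeg (Const 0), move cAcc (Const 0), move cRej (Const 0),
      move cDen (Const 1)]"

definition scan :: com where
  "scan = Seq scan_init (WhileLess (Reg cI) (Reg cN) scan_body)"

definition cover_body :: com where
  "cover_body = block
     [edge_address,
      IfLess (Const 0) (Inp cAddr)
        (block [Assign cAddr Add (Reg cI) (Const covered), Store cAddr (Const 1)])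
        Skip,
      Assign cI Add (Reg cI) (Const 1)]"

definition cover :: com where
  "cover = Seq (move cI (Const 0)) (WhileLess (Reg cI) (Reg cN) cover_body)"

text \<open>The machine only tests for strict inequality, so equality of degree and size is tested
  by excluding both strict orders. The gain is positive iff the numerator of the acceptable part is
  the larger one.\<close>

definition select_body :: com where
  "select_body = Seq scan
     (Seq
       (IfLess (Reg cDeg) (Reg cSize) Skip
         (IfLess (Reg cSize) (Reg cDeg) Skip
           (IfLess (Reg cRej) (Reg cAcc) cover Skip)))
       (Assign cJ Add (Reg cJ) (Const 1)))"

text \<open>The size is incremented at the start of a round: the memory starts at 0, while the
  smallest neighbourhoods have size 1.\<close>

definition size_body :: com where
  "size_body = Seq (Assign cSize Add (Reg cSize) (Const 1))
     (Seq (move cJ (Const 0)) (WhileLess (Reg cJ) (Reg cM) select_body))"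

text \<open>Probabilities are positive, so a neighbourhood is covered iff its uncovered mass is 0.
  The values 0 and 1 are written as 0/1 and 1/1.\<close>

definition output_body :: com where
  "output_body = Seq scan
     (block
       [Assign cAddr Add (Reg cAcc) (Reg cRej),
        IfLess (Const 0) (Reg cAddr) (Write (Const 0)) (Write (Const 1)),
        Write (Const 1),
        Assign cJ Add (Reg cJ) (Const 1)])"

definition main_init :: com where
  "main_init = block
     [move cAddr (Const 1), move cN (Inp cAddr),
      move cAddr (Const 2), move cM (Inp cAddr),
      Assign cOff Add (Reg cN) (Reg cN),
      Assign cOff Add (Reg cOff) (Reg cN),
      Assign cOff Add (Reg cOff) (Const 3)]"

definition delegation_com :: com where
  "delegation_com = Seq main_init
     (Seq (WhileLess (Reg cSize) (Reg cN) size_body)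
       (Seq (move cJ (Const 0)) (WhileLess (Reg cJ) (Reg cM) output_body)))"

lemmas program_defs = edge_address_def add_prob_def scan_body_def scan_init_def cover_body_def
  main_init_def

section \<open>Instances and the layout of their encoding\<close>

locale enumerated_instance =
  fixes I :: "('s, 'g) delegation" and ts :: "'s list" and ss :: "'g list"
  assumes inst: "delegation_instance I"
    and ts: "enumerates ts (states I)" and ss: "enumerates ss (signals I)"
begin

abbreviation "input \<equiv> encode_instance I ts ss"
abbreviation "size_bound \<equiv> input_size input + 5"
abbreviation "n \<equiv> length ts"
abbreviation "m \<equiv> length ss"
abbreviation "nbr j \<equiv> nbrs_signal I (ss ! j)"
abbreviation "pr i \<equiv> (of_rat (prob I (ts ! i)) :: real)"

definition num :: "nat \<Rightarrow> nat" where "num i = nat (fst (quotient_of (prob I (ts ! i))))"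
definition den :: "nat \<Rightarrow> nat" where "den i = nat (snd (quotient_of (prob I (ts ! i))))"

sublocale bounded_ram input size_bound
  by unfold_locales (simp_all add: input_cell_less)

lemma length_encode_rats: "length (concat (map (\<lambda>\<theta>. encode_rat (prob I \<theta>)) ts)) = n * 2"
  by (rule length_concat_map_uniform) (simp add: encode_rat_def)

lemma length_input: "length input = 2 + 3 * n + n * m"
  using length_encode_rats length_concat_map_uniform[of ts "\<lambda>\<theta>. map (\<lambda>\<sigma>. of_bool ((\<theta>, \<sigma>) \<in> edges I)) ss" m]
  by (simp add: encode_instance_def)

lemma input_cell_Suc: "a = Suc i \<Longrightarrow> i < length x \<Longrightarrow> input_cell x a = x ! i"
  by (simp add: input_cell_def)

lemma cell_sizes: "input_cell input (Suc 0) = n" "input_cell input 2 = m"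
  using length_input by (simp_all add: input_cell_def encode_instance_def numeral_2_eq_2)

lemma cell_acceptable:
  assumes "i < n"
  shows "input_cell input (3 + i) = of_bool (ts ! i \<in> acceptable I)"
proof -
  have "input_cell input (3 + i) = input ! (2 + i)"
    using assms length_input by (intro input_cell_Suc) simp_all
  then show ?thesis using assms by (simp add: encode_instance_def nth_append)
qed

lemma cell_rat:
  assumes "i < n" "k < 2"
  shows "input_cell input (3 + n + 2 * i + k) = encode_rat (prob I (ts ! i)) ! k"
proof -
  have "input_cell input (3 + n + 2 * i + k) = input ! (2 + n + 2 * i + k)"
    using assms length_input by (intro input_cell_Suc) simp_all
  also have "\<dots> = concat (map (\<lambda>\<theta>. encode_rat (prob I \<theta>)) ts) ! (i * 2 + k)"
    using assms length_encode_rats by (simp add: encode_instance_def nth_append mult.commute)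
  also have "\<dots> = encode_rat (prob I (ts ! i)) ! k"
    using assms by (intro nth_concat_map_uniform) (auto simp: encode_rat_def)
  finally show ?thesis by simp
qed

lemma cell_num: "i < n \<Longrightarrow> input_cell input (3 + n + 2 * i) = num i"
  and cell_den: "i < n \<Longrightarrow> input_cell input (Suc (3 + n + 2 * i)) = den i"
  using cell_rat[of i 0] cell_rat[of i 1] by (simp_all add: encode_rat_def num_def den_def)

lemma cell_edge:
  assumes "i < n" "j < m"
  shows "input_cell input (i * m + j + (3 + 3 * n)) = of_bool (ts ! i \<in> nbr j)"
proof -
  have "i * m + j < n * m"
    using assms by (metis Suc_leI add_less_cancel_left less_le_trans mult_Suc mult_le_mono1 add.commute)
  then have "input_cell input (i * m + j + (3 + 3 * n)) = input ! (2 + 3 * n + (i * m + j))"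
    using length_input by (intro input_cell_Suc) simp_all
  also have "\<dots> = concat (map (\<lambda>\<theta>. map (\<lambda>\<sigma>. of_bool ((\<theta>, \<sigma>) \<in> edges I)) ss) ts) ! (i * m + j)"
    using assms length_encode_rats by (simp add: encode_instance_def nth_append)
  also have "\<dots> = map (\<lambda>\<sigma>. of_bool ((ts ! i, \<sigma>) \<in> edges I)) ss ! j"
    using assms by (intro nth_concat_map_uniform) auto
  finally show ?thesis using assms by (simp add: nbrs_signal_def algebra_simps)
qed

lemma states: "finite (states I)" "acceptable I \<inter> rejectable I = {}"
  and prob_pos: "\<theta> \<in> states I \<Longrightarrow> 0 < prob I \<theta>"
  and prob_sum: "(\<Sum>\<theta>\<in>states I. prob I \<theta>) = 1"
  and nbr_states: "nbrs_signal I \<sigma> \<subseteq> states I"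
  using inst by (auto simp: delegation_instance_def nbrs_signal_def)

lemma sum_nth_states: "(\<Sum>i<n. f (ts ! i)) = sum f (states I)"
proof -
  have "bij_betw ((!) ts) {..<n} (states I)"
    using ts bij_betw_nth[of ts "{..<n}" "states I"] by (auto simp: enumerates_def)
  then show ?thesis by (rule sum.reindex_bij_betw)
qed

lemma sum_nth_subset: "X \<subseteq> states I \<Longrightarrow> (\<Sum>i<n. if ts ! i \<in> X then f (ts ! i) else 0) = sum f X"
  unfolding sum_nth_states[of "\<lambda>\<theta>. if \<theta> \<in> X then f \<theta> else 0"]
  using sum.inter_restrict[OF states(1), of f X] by (simp add: Int_absorb1)

lemma nth_states: "i < n \<Longrightarrow> ts ! i \<in> states I"
  using ts nth_mem[of i ts] by (simp only: enumerates_def)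

lemma pr_nonneg: "i < n \<Longrightarrow> 0 \<le> pr i"
  unfolding zero_le_of_rat_iff by (intro less_imp_le prob_pos nth_states)

lemma pr_sum: "(\<Sum>i<n. pr i) = 1"
proof -
  have "(\<Sum>i<n. pr i) = of_rat (\<Sum>i<n. prob I (ts ! i))" by (simp add: of_rat_sum)
  then show ?thesis by (simp only: sum_nth_states prob_sum of_rat_1)
qed

lemma den_pos: "0 < den i"
  by (simp add: den_def quotient_of_denom_pos')

lemma num_eq:
  assumes "i < n"
  shows "real (num i) = pr i * real (den i)"
proof -
  obtain a c where ac: "quotient_of (prob I (ts ! i)) = (a, c)" by force
  have c: "0 < c" using quotient_of_denom_pos[OF ac] .
  have q: "prob I (ts ! i) = of_int a / of_int c" using quotient_of_div[OF ac] .
  with prob_pos[OF nth_states[OF assms]] c have "0 < a" by (simp add: zero_less_divide_iff)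
  moreover have "pr i = of_int a / of_int c" unfolding q by (simp add: of_rat_divide)
  ultimately show ?thesis using c by (simp add: num_def den_def ac)
qed

text \<open>Every denominator is itself an entry of the input, so their bit lengths add up to at
  most the input size.\<close>

lemma den_prod_less: "(\<Prod>i<n. den i) < 2 ^ size_bound"
proof -
  have "(\<Prod>i<n. den i) \<le> (\<Prod>i<n. 2 ^ bit_length (den i))"
    by (intro prod_mono) (auto intro: less_imp_le less_two_power_bit_length)
  also have "\<dots> = 2 ^ (\<Sum>i<n. bit_length (den i))"
    by (simp add: power_sum)
  also have "(\<Sum>i<n. bit_length (den i)) \<le> input_size input"
  proof -
    have "(\<Sum>i<n. bit_length (den i)) = (\<Sum>\<theta>\<leftarrow>ts. bit_length (nat (snd (quotient_of (prob I \<theta>)))))"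
      by (simp add: den_def sum_list_sum_nth atLeast0LessThan)
    also have "\<dots> \<le> input_size (concat (map (\<lambda>\<theta>. encode_rat (prob I \<theta>)) ts))"
      by (induction ts) (auto simp: input_size_def encode_rat_def)
    also have "\<dots> \<le> input_size input"
      by (simp add: encode_instance_def input_size_def)
    finally show ?thesis .
  qed
  then have "(2::nat) ^ (\<Sum>i<n. bit_length (den i)) < 2 ^ size_bound"
    by (intro power_strict_increasing) auto
  finally show ?thesis .
qed

lemma den_prod_mono: "i \<le> n \<Longrightarrow> (\<Prod>k<i. den k) \<le> (\<Prod>k<n. den k)"
  by (intro dvd_imp_le prod_dvd_prod_subset prod_pos) (auto simp: den_pos)

lemma length_input_le: "length input \<le> input_size input"
proof -
  have "length x \<le> input_size x" for x :: "nat list"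
    by (induction x) (auto simp: input_size_def bit_length_def)
  then show ?thesis .
qed

lemma n_pos: "0 < n"
  using pr_sum by (cases ts) auto

text \<open>The number \<open>m\<close> is given in binary, so its own entry does not bound it by
  the input size; the matrix, with at least one row, does.\<close>

lemma m_le: "m \<le> n * m"
  using n_pos by (cases n) auto

text \<open>Meant for counters and addresses, which exceed the input length by a small constant at
  most; 30 is below \<open>2 ^ 5\<close>.\<close>

lemma small_numbers: "v \<le> length input + 30 \<Longrightarrow> v < 2 ^ size_bound"
proof -
  have "(k::nat) + 30 < 2 ^ (k + 5)" for k
  proof (induction k)
    case (Suc k)
    have "(2::nat) ^ (Suc k + 5) = 2 * 2 ^ (k + 5)" by (simp only: add_Suc power_Suc)
    with Suc show ?case by linarith
  qed simp
  then show "v \<le> length input + 30 \<Longrightarrow> v < 2 ^ size_bound"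
    using length_input_le by (meson add_le_mono1 le_less_trans order_trans)
qed

section \<open>Scanning the neighbourhood of a signal\<close>

definition deg :: "nat \<Rightarrow> nat \<Rightarrow> nat" where
  "deg j i = (\<Sum>k<i. of_bool (ts ! k \<in> nbr j))"

definition mass :: "'s set \<Rightarrow> nat \<Rightarrow> real" where
  "mass X i = (\<Sum>k<i. if ts ! k \<in> X then pr k else 0)"

definition loaded :: "'s set \<Rightarrow> memory \<Rightarrow> bool" where
  "loaded C s \<longleftrightarrow> s cN = n \<and> s cM = m \<and> s cOff = 3 + 3 * n \<and>
     (\<forall>i<n. s (i + covered) = of_bool (ts ! i \<in> C))"

text \<open>For \<open>cDen\<close> there is only an upper bound, because the denominators of
  skipped states are not multiplied in. The numerators are therefore described relative to
  \<open>cDen\<close>.\<close>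

definition scan_inv ::
  "'s set \<Rightarrow> nat \<Rightarrow> nat \<Rightarrow> nat list \<Rightarrow> nat \<Rightarrow> memory \<Rightarrow> nat list \<Rightarrow> bool" where
  "scan_inv C l j z i s y \<longleftrightarrow> loaded C s \<and> s cSize = l \<and> s cJ = j \<and> y = z \<and> s cI = i \<and>
     s cDeg = deg j i \<and> 0 < s cDen \<and> s cDen \<le> (\<Prod>k<i. den k) \<and>
     real (s cAcc) = mass ((nbr j - C) \<inter> acceptable I) i * real (s cDen) \<and>
     real (s cRej) = mass (nbr j - C - acceptable I) i * real (s cDen)"

lemma deg_Suc: "deg j (Suc i) = deg j i + of_bool (ts ! i \<in> nbr j)"
  by (simp add: deg_def)

lemma mass_Suc: "mass X (Suc i) = mass X i + (if ts ! i \<in> X then pr i else 0)"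
  by (simp add: mass_def)

lemma deg_le: "deg j i \<le> i"
  using sum_bounded_above[of "{..<i}" "\<lambda>k. of_bool (ts ! k \<in> nbr j)" "1 :: nat"] by (simp add: deg_def)

lemma mass_add_pr_le_1:
  assumes "i < n"
  shows "mass X i + pr i \<le> 1"
proof -
  have "mass X i \<le> (\<Sum>k<i. pr k)"
    unfolding mass_def using assms pr_nonneg by (intro sum_mono) auto
  then have "mass X i + pr i \<le> (\<Sum>k<Suc i. pr k)" by simp
  also have "\<dots> \<le> (\<Sum>k<n. pr k)"
    using assms pr_nonneg by (intro sum_mono2) auto
  finally show "mass X i + pr i \<le> 1" using pr_sum by simp
qed

text \<open>Masses are at most 1, even with the next probability added, so a numerator never exceeds
  its denominator and only the denominator has to be controlled.\<close>

lemma fraction_bounds: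
  assumes i: "i < n" and d: "d \<le> (\<Prod>k<i. den k)" and a: "real a = mass X i * real d"
  shows "a * den i + num i * d < 2 ^ size_bound" "d * den i < 2 ^ size_bound"
proof -
  have "d * den i \<le> (\<Prod>k<Suc i. den k)" using d by simp
  also have "\<dots> \<le> (\<Prod>k<n. den k)" using i by (intro den_prod_mono) simp
  also note den_prod_less
  finally show *: "d * den i < 2 ^ size_bound" .
  have "real (a * den i + num i * d) = (mass X i + pr i) * real (d * den i)"
    using a num_eq[OF i] by (simp add: algebra_simps)
  also have "\<dots> \<le> 1 * real (d * den i)"
    using mass_add_pr_le_1[OF i] by (intro mult_right_mono) auto
  finally have "a * den i + num i * d \<le> d * den i"
    by (simp only: mult_1 of_nat_le_iff)
  with * show "a * den i + num i * d < 2 ^ size_bound" by simp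
qed

lemma triple_scan_body:
  assumes i: "i < n" and j: "j < m"
  shows "triple (scan_inv C l j z i) scan_body 30 (scan_inv C l j z (Suc i))"
proof -
  have "i * m + m \<le> n * m"
    using i mult_le_mono1[of "Suc i" n m] by simp
  then have index: "i * m + j < n * m" using j by simp
  have deg: "deg j i < n" using deg_le[of j i] i by simp
  \<comment> \<open>The overflow conditions of \<open>wp\<close> for all intermediate addresses and
    counters.\<close>
  have small: "i * m < 2 ^ size_bound" "i * m + j < 2 ^ size_bound" "i * m + j + (3 + 3 * n) < 2 ^ size_bound"
    "Suc (deg j i) < 2 ^ size_bound" "i + covered < 2 ^ size_bound" "Suc i < 2 ^ size_bound"
    "i + i < 2 ^ size_bound" "i + i + n < 2 ^ size_bound" "2 * i + (n + 3) < 2 ^ size_bound"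
    "4 + (2 * i + n) < 2 ^ size_bound" "i + 3 < 2 ^ size_bound"
    using index deg i by (intro small_numbers; simp add: length_input)+
  have cells: "input_cell input (i + 3) = of_bool (ts ! i \<in> acceptable I)"
    "input_cell input (2 * i + (n + 3)) = num i" "input_cell input (4 + (2 * i + n)) = den i"
    using cell_acceptable[OF i] cell_num[OF i] cell_den[OF i] by (simp_all add: ac_simps)
  have "triple (scan_inv C l j z i) scan_body (steps scan_body) (scan_inv C l j z (Suc i))"
  proof (rule triple_wp)
    fix s y assume inv: "scan_inv C l j z i s y"
    then have acc: "s cAcc * den i + num i * s cDen < 2 ^ size_bound"
      and rej: "s cRej * den i + num i * s cDen < 2 ^ size_bound"
      and d: "s cDen * den i < 2 ^ size_bound"
      using fraction_bounds[OF i] unfolding scan_inv_def by blast+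
    \<comment> \<open>Needed when state \<open>i\<close> is skipped: \<open>cDen\<close> stays the
      same while its bound moves on to \<open>Suc i\<close>.\<close>
    have "s cDen \<le> (\<Prod>k<i. den k)" using inv by (simp add: scan_inv_def)
    also have "\<dots> \<le> (\<Prod>k<i. den k) * den i" using den_pos[of i] by simp
    finally have d': "s cDen \<le> (\<Prod>k<i. den k) * den i" .
    have num: "num i < 2 ^ size_bound" "den i < 2 ^ size_bound"
      using input_bound[of "2 * i + (n + 3)"] input_bound[of "4 + (2 * i + n)"] unfolding cells by auto
    show "wp size_bound input scan_body (scan_inv C l j z (Suc i)) s y"
      using inv i j small num d' acc rej d den_pos[of i] num_eq[OF i]
      by (simp add: scan_inv_def loaded_def program_defs cell_edge cells deg_Suc mass_Suc)
         (auto simp: algebra_simps)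
  qed (simp add: program_defs)
  then show ?thesis by (rule triple_conseq) (simp_all add: program_defs)
qed

definition ready :: "'s set \<Rightarrow> nat \<Rightarrow> nat \<Rightarrow> nat list \<Rightarrow> memory \<Rightarrow> nat list \<Rightarrow> bool" where
  "ready C l j z s y \<longleftrightarrow> loaded C s \<and> s cSize = l \<and> s cJ = j \<and> y = z"

lemma triple_scan:
  assumes "j < m"
  shows "triple (ready C l j z) scan (31 * n + 7) (scan_inv C l j z n)"
proof -
  have "triple (ready C l j z) scan_init (steps scan_init) (scan_inv C l j z 0)"
    by (rule triple_wp)
       (auto simp: program_defs ready_def scan_inv_def loaded_def deg_def mass_def small_numbers)
  moreover have "triple (scan_inv C l j z 0) (WhileLess (Reg cI) (Reg cN) scan_body)
      (n * (30 + 1) + 1) (scan_inv C l j z n)"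
    by (rule triple_for[where Inv = "scan_inv C l j z"], erule triple_scan_body[OF _ assms])
       (simp_all add: scan_inv_def loaded_def)
  ultimately have "triple (ready C l j z) scan (steps scan_init + (n * (30 + 1) + 1)) (scan_inv C l j z n)"
    unfolding scan_def by (rule triple_seq)
  then show ?thesis by (rule triple_conseq) (simp_all add: program_defs)
qed

lemma deg_n: "deg j n = card (nbr j)"
proof -
  have "deg j n = (\<Sum>i<n. if ts ! i \<in> nbr j then 1 else 0)"
    unfolding deg_def by (intro sum.cong) auto
  also have "\<dots> = (\<Sum>\<theta>\<in>nbr j. 1)"
    by (rule sum_nth_subset[where f = "\<lambda>_. 1"]) (rule nbr_states)
  finally show ?thesis by simp
qed

lemma mass_n: "X \<subseteq> states I \<Longrightarrow> mass X n = (\<Sum>\<theta>\<in>X. of_rat (prob I \<theta>))"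
  unfolding mass_def by (rule sum_nth_subset)

lemma sum_weight:
  assumes "X \<subseteq> states I"
  shows "sum (weight I) X = mass (X \<inter> acceptable I) n - mass (X - acceptable I) n"
proof -
  have "finite X" using assms states(1) finite_subset by blast
  then have "sum (weight I) X = sum (weight I) (X \<inter> acceptable I) + sum (weight I) (X - acceptable I)"
    by (rule sum.Int_Diff)
  also have "sum (weight I) (X \<inter> acceptable I) = mass (X \<inter> acceptable I) n"
    using assms by (subst mass_n) (auto simp: weight_def intro!: sum.cong)
  also have "sum (weight I) (X - acceptable I) = - mass (X - acceptable I) n"
    using assms by (subst mass_n) (auto simp: weight_def sum_negf[symmetric] intro!: sum.cong)
  finally show ?thesis by simp
qed

lemma mass_split: "mass X i = mass (X \<inter> Y) i + mass (X - Y) i"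
  unfolding mass_def by (subst sum.distrib[symmetric]) (auto intro!: sum.cong)

text \<open>Positivity of the probabilities lets a zero mass certify an empty set; the output test
  rests on this.\<close>

lemma mass_eq_0_iff:
  assumes "X \<subseteq> states I" shows "mass X n = 0 \<longleftrightarrow> X = {}"
proof -
  have "finite X" using assms states(1) finite_subset by blast
  moreover have "0 < (of_rat (prob I \<theta>) :: real)" if "\<theta> \<in> X" for \<theta>
    using that assms prob_pos by auto
  ultimately have "X \<noteq> {} \<Longrightarrow> 0 < (\<Sum>\<theta>\<in>X. of_rat (prob I \<theta>) :: real)"
    by (intro sum_pos) auto
  then show ?thesis using mass_n[OF assms] by (metis less_irrefl sum.empty)
qed

lemma mass_le_1: "mass X n \<le> 1"
proof -
  have "mass X n \<le> (\<Sum>k<n. pr k)"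
    unfolding mass_def using pr_nonneg by (intro sum_mono) auto
  then show ?thesis using pr_sum by simp
qed

section \<open>Covering a neighbourhood\<close>

definition cover_inv ::
  "'s set \<Rightarrow> nat \<Rightarrow> nat \<Rightarrow> nat list \<Rightarrow> nat \<Rightarrow> memory \<Rightarrow> nat list \<Rightarrow> bool" where
  "cover_inv C l j z i s y \<longleftrightarrow> s cN = n \<and> s cM = m \<and> s cOff = 3 + 3 * n \<and>
     (\<forall>k<n. s (k + covered) = of_bool (ts ! k \<in> C \<or> k < i \<and> ts ! k \<in> nbr j)) \<and>
     s cSize = l \<and> s cJ = j \<and> y = z \<and> s cI = i"

lemma triple_cover_body:
  assumes i: "i < n" and j: "j < m"
  shows "triple (cover_inv C l j z i) cover_body 10 (cover_inv C l j z (Suc i))"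
proof -
  have "i * m + m \<le> n * m"
    using i mult_le_mono1[of "Suc i" n m] by simp
  then have index: "i * m + j < n * m" using j by simp
  have small: "i * m < 2 ^ size_bound" "i * m + j < 2 ^ size_bound" "i * m + j + (3 + 3 * n) < 2 ^ size_bound"
    "i + covered < 2 ^ size_bound" "Suc i < 2 ^ size_bound"
    using index i by (intro small_numbers; simp add: length_input)+
  have "triple (cover_inv C l j z i) cover_body (steps cover_body) (cover_inv C l j z (Suc i))"
    by (rule triple_wp)
       (use i j small in \<open>auto simp: cover_inv_def program_defs cell_edge less_Suc_eq\<close>)
  then show ?thesis by (rule triple_conseq) (simp_all add: program_defs)
qed

lemma triple_cover:
  assumes "j < m"
  shows "triple (ready C l j z) cover (11 * n + 2) (ready (C \<union> nbr j) l j z)"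
proof -
  have "triple (ready C l j z) (move cI (Const 0)) 1 (cover_inv C l j z 0)"
    using triple_wp[of "ready C l j z" "move cI (Const 0)" "cover_inv C l j z 0"]
    by (simp add: ready_def loaded_def cover_inv_def)
  moreover have "triple (cover_inv C l j z 0) (WhileLess (Reg cI) (Reg cN) cover_body)
      (n * (10 + 1) + 1) (cover_inv C l j z n)"
    by (rule triple_for[where Inv = "cover_inv C l j z"], erule triple_cover_body[OF _ assms])
       (simp_all add: cover_inv_def)
  ultimately have "triple (ready C l j z) cover (1 + (n * (10 + 1) + 1)) (cover_inv C l j z n)"
    unfolding cover_def by (rule triple_seq)
  then show ?thesis
    by (rule triple_conseq) (simp_all add: cover_inv_def ready_def loaded_def)
qed

section \<open>One greedy step and one output step\<close>

definition select :: "nat \<Rightarrow> nat \<Rightarrow> 's set \<Rightarrow> 's set" where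
  "select l j C = (if card (nbr j) = l \<and> 0 < sum (weight I) (nbr j - C) then C \<union> nbr j else C)"

lemma scan_inv_ready: "scan_inv C l j z n s y \<Longrightarrow> ready C l j z s y"
  by (simp add: scan_inv_def ready_def)

lemma scan_inv_deg: "scan_inv C l j z n s y \<Longrightarrow> s cDeg = card (nbr j)"
  by (simp add: scan_inv_def deg_n)

text \<open>The numerators stand over the same positive denominator, and their difference is the
  weight of the uncovered part scaled by it.\<close>

lemma scan_inv_gain:
  assumes "scan_inv C l j z n s y"
  shows "s cRej < s cAcc \<longleftrightarrow> 0 < sum (weight I) (nbr j - C)"
proof -
  have d: "0 < real (s cDen)" using assms by (simp add: scan_inv_def)
  have "nbr j - C \<subseteq> states I" using nbr_states by blast
  from sum_weight[OF this] have "real (s cAcc) - real (s cRej) = sum (weight I) (nbr j - C) * real (s cDen)"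
    using assms by (simp add: scan_inv_def left_diff_distrib)
  then have "real (s cRej) < real (s cAcc) \<longleftrightarrow> 0 < sum (weight I) (nbr j - C) * real (s cDen)"
    by linarith
  also have "\<dots> \<longleftrightarrow> 0 < sum (weight I) (nbr j - C)" using d by (simp add: zero_less_mult_iff)
  finally show ?thesis by simp
qed

text \<open>The bound is the overflow condition for the addition in \<open>output_body\<close>; it
  holds since the total uncovered mass is at most 1.\<close>

lemma scan_inv_uncovered:
  assumes "scan_inv C l j z n s y"
  shows "0 < s cAcc + s cRej \<longleftrightarrow> \<not> nbr j \<subseteq> C" "s cAcc + s cRej < 2 ^ size_bound"
proof -
  have d: "0 < real (s cDen)" "s cDen \<le> (\<Prod>k<n. den k)" using assms by (simp_all add: scan_inv_def)
  have eq: "real (s cAcc + s cRej) = mass (nbr j - C) n * real (s cDen)"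
    using assms mass_split[of "nbr j - C" n "acceptable I"]
    by (simp add: scan_inv_def distrib_right)
  have "nbr j - C \<subseteq> states I" using nbr_states by blast
  from mass_eq_0_iff[OF this] have "s cAcc + s cRej = 0 \<longleftrightarrow> nbr j \<subseteq> C"
    using eq d(1) by (simp only: of_nat_eq_0_iff[symmetric, where 'a = real] mult_eq_0_iff) auto
  then show "0 < s cAcc + s cRej \<longleftrightarrow> \<not> nbr j \<subseteq> C" by auto
  have "real (s cAcc + s cRej) \<le> 1 * real (s cDen)"
    unfolding eq using mass_le_1 by (intro mult_right_mono) auto
  then have "s cAcc + s cRej \<le> s cDen" by (simp only: mult_1 of_nat_le_iff)
  then show "s cAcc + s cRej < 2 ^ size_bound" using d(2) den_prod_less by linarith
qed

lemma scan_inv_facts: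
  assumes "scan_inv C l j z n s y"
  shows "ready C l j z s y \<and> s cSize = l \<and> s cDeg = card (nbr j) \<and>
    (s cRej < s cAcc \<longleftrightarrow> 0 < sum (weight I) (nbr j - C))"
  using assms scan_inv_ready[OF assms] scan_inv_deg[OF assms] scan_inv_gain[OF assms]
  by (simp add: scan_inv_def)

lemma triple_select_body:
  assumes j: "j < m"
  shows "triple (ready C l j z) select_body (42 * n + 13) (ready (select l j C) l (Suc j) z)"
proof -
  let ?Q = "ready (select l j C) l j z"
  let ?T = "11 * n + 2"
  have skip: "triple P Skip T ?Q"
    if P: "\<And>s y. P s y \<Longrightarrow> ready C l j z s y \<and> select l j C = C" and T: "1 \<le> T" for P T
  proof -
    have "wp size_bound input Skip ?Q s y" if "P s y" for s y
      using P[OF that] by simp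
    then have "triple P Skip (steps Skip) ?Q" by (rule triple_wp) simp_all
    then show ?thesis by (rule triple_conseq) (use T in simp_all)
  qed
  have cov: "triple P cover ?T ?Q"
    if "\<And>s y. P s y \<Longrightarrow> ready C l j z s y \<and> select l j C = C \<union> nbr j" for P
  \<comment> \<open>The equation for \<open>select l j C\<close> does not mention the memory, so a
    single state that satisfies \<open>P\<close> yields it; without such a state the triple is
    vacuous.\<close>
  proof (cases "\<exists>s y. P s y")
    case True
    then have "select l j C = C \<union> nbr j" using that by blast
    then have "triple (ready C l j z) cover ?T ?Q" using triple_cover[OF j, of C l z] by simp
    then show ?thesis by (rule triple_conseq) (use that in blast, assumption, rule order_refl)
  next
    case False
    then show ?thesis by (simp add: triple_def)
  qed
  have "triple (scan_inv C l j z n) (IfLess (Reg cDeg) (Reg cSize) Skip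
         (IfLess (Reg cSize) (Reg cDeg) Skip
           (IfLess (Reg cRej) (Reg cAcc) cover Skip))) (?T + 1 + 1 + 1) ?Q"
    by (intro triple_if skip cov) (auto dest!: scan_inv_facts simp: select_def)
  moreover have "triple ?Q (Assign cJ Add (Reg cJ) (Const 1)) 1 (ready (select l j C) l (Suc j) z)"
  proof -
    have "Suc j < 2 ^ size_bound"
      using j m_le length_input by (intro small_numbers) linarith
    then show ?thesis
      using triple_wp[of ?Q "Assign cJ Add (Reg cJ) (Const 1)" "ready (select l j C) l (Suc j) z"]
      by (simp add: ready_def loaded_def)
  qed
  ultimately show ?thesis
    unfolding select_body_def
    by (rule triple_conseq[OF triple_seq[OF triple_scan[OF j] triple_seq]]) simp_all
qed

lemma triple_output_body:
  assumes j: "j < m"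
  shows "triple (ready C l j z) output_body (31 * n + 13)
    (ready C l (Suc j) (z @ (if nbr j \<subseteq> C then [1, 1] else [0, 1])))"
    (is "triple _ _ _ ?Q")
proof -
  have small: "Suc j < 2 ^ size_bound" using j m_le length_input by (intro small_numbers) linarith
  let ?c = "block
       [Assign cAddr Add (Reg cAcc) (Reg cRej),
        IfLess (Const 0) (Reg cAddr) (Write (Const 0)) (Write (Const 1)),
        Write (Const 1),
        Assign cJ Add (Reg cJ) (Const 1)]"
  have "triple (scan_inv C l j z n) ?c (steps ?c) ?Q"
  proof (rule triple_wp)
    fix s y assume inv: "scan_inv C l j z n s y"
    have r: "ready C l j z s y" using scan_inv_ready[OF inv] .
    show "wp size_bound input ?c ?Q s y"
      using r scan_inv_uncovered[OF inv] small
      by (auto simp: ready_def loaded_def)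
  qed simp
  from triple_seq[OF triple_scan[OF j] this] show ?thesis
    unfolding output_body_def by (rule triple_conseq) simp_all
qed

section \<open>The greedy loops\<close>

definition processed :: "nat \<Rightarrow> nat \<Rightarrow> nat set" where
  "processed l j = {k. k < m \<and> (card (nbr k) < l \<or> card (nbr k) = l \<and> k < j)}"

text \<open>The nested loops meet the signals in the lexicographic order of size and index. What was
  met before is not larger than \<open>nbr j\<close>, so laminarity leaves only the two cases that
  \<open>best_cover_insert\<close> admits.\<close>

lemma best_cover_select:
  assumes lam: "laminar_states I" and j: "j < m"
    and best: "best_cover (weight I) nbr (processed l j) C"
  shows "best_cover (weight I) nbr (processed l (Suc j)) (select l j C)"
proof (cases "card (nbr j) = l")
  case False
  then have "processed l (Suc j) = processed l j"
    unfolding processed_def by (auto simp: less_Suc_eq)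
  then show ?thesis using best False by (simp add: select_def)
next
  case True
  have fin: "finite (nbr k)" for k
    using nbr_states states(1) finite_subset by blast
  have sub: "nbr k \<subseteq> nbr j \<or> nbr k \<inter> nbr j = {}" if "k \<in> processed l j" for k
  proof -
    from that have k: "k < m" "card (nbr k) \<le> card (nbr j)"
      using True by (auto simp: processed_def)
    have "ss ! k \<in> signals I" "ss ! j \<in> signals I"
      using ss k(1) j nth_mem by (auto simp only: enumerates_def)
    then have "nbr k \<inter> nbr j = {} \<or> nbr k \<subseteq> nbr j \<or> nbr j \<subseteq> nbr k"
      using lam unfolding laminar_states_def laminar_def by blast
    \<comment> \<open>Inclusion in the wrong direction forces equality, by cardinality.\<close>
    moreover have "nbr k = nbr j" if "nbr j \<subseteq> nbr k"
      using card_seteq[OF fin that k(2)] by simp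
    ultimately show ?thesis by blast
  qed
  have eq: "processed l (Suc j) = insert j (processed l j)"
    using True j unfolding processed_def by (auto simp: less_Suc_eq)
  have "best_cover (weight I) nbr (insert j (processed l j))
      (if 0 < sum (weight I) (nbr j - C) then C \<union> nbr j else C)"
    using best states(1) nbr_states sub by (rule best_cover_insert)
  then show ?thesis unfolding eq using True by (simp add: select_def)
qed

definition best_ready :: "nat \<Rightarrow> nat \<Rightarrow> memory \<Rightarrow> nat list \<Rightarrow> bool" where
  "best_ready l j s y \<longleftrightarrow> (\<exists>C. best_cover (weight I) nbr (processed l j) C \<and> ready C l j [] s y)"

lemma triple_select:
  assumes lam: "laminar_states I" and j: "j < m"
  shows "triple (best_ready l j) select_body (42 * n + 13) (best_ready l (Suc j))"
  unfolding best_ready_def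
proof (rule triple_ex)
  fix C
  show "triple (\<lambda>s y. best_cover (weight I) nbr (processed l j) C \<and> ready C l j [] s y)
      select_body (42 * n + 13)
      (\<lambda>s y. \<exists>C. best_cover (weight I) nbr (processed l (Suc j)) C \<and> ready C l (Suc j) [] s y)"
  proof (cases "best_cover (weight I) nbr (processed l j) C")
    case True
    from triple_select_body[OF j] show ?thesis
      by (rule triple_conseq) (use best_cover_select[OF lam j True] in blast)+
  next
    case False
    then show ?thesis by (simp add: triple_def)
  qed
qed

text \<open>Between rounds \<open>cSize\<close> is the size just finished, hence the shift to
  \<open>Suc l\<close>. The signal index is arbitrary because it is reset before its next
  use.\<close>

definition size_inv :: "nat \<Rightarrow> memory \<Rightarrow> nat list \<Rightarrow> bool" where
  "size_inv l s y \<longleftrightarrow>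
     (\<exists>C j. best_cover (weight I) nbr (processed (Suc l) 0) C \<and> ready C l j [] s y)"

lemma triple_size_body:
  assumes lam: "laminar_states I" and l: "l < n"
  shows "triple (size_inv l) size_body (m * (42 * n + 14) + 3) (size_inv (Suc l))"
proof -
  have small: "Suc l < 2 ^ size_bound"
    using l length_input by (intro small_numbers) linarith
  let ?Q = "\<lambda>s y. \<exists>C. best_cover (weight I) nbr (processed (Suc l) 0) C \<and>
      (\<exists>j. ready C (Suc l) j [] s y)"
  have "triple (size_inv l) (Assign cSize Add (Reg cSize) (Const 1))
      (steps (Assign cSize Add (Reg cSize) (Const 1))) ?Q"
    by (rule triple_wp) (use small in \<open>auto simp: size_inv_def ready_def loaded_def\<close>)
  moreover have "triple ?Q (move cJ (Const 0)) (steps (move cJ (Const 0))) (best_ready (Suc l) 0)"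
    by (rule triple_wp) (auto simp: best_ready_def ready_def loaded_def)
  moreover have "triple (best_ready (Suc l) 0) (WhileLess (Reg cJ) (Reg cM) select_body)
      (m * (42 * n + 13 + 1) + 1) (best_ready (Suc l) m)"
    by (rule triple_for[where Inv = "best_ready (Suc l)"], erule triple_select[OF lam])
       (auto simp: best_ready_def ready_def loaded_def)
  ultimately have "triple (size_inv l) size_body
      (steps (Assign cSize Add (Reg cSize) (Const 1)) +
       (steps (move cJ (Const 0)) + (m * (42 * n + 13 + 1) + 1))) (best_ready (Suc l) m)"
    unfolding size_body_def by (intro triple_seq)
  moreover have "processed (Suc l) m = processed (Suc (Suc l)) 0"
    unfolding processed_def by auto
  ultimately show ?thesis
    by (elim triple_conseq) (auto simp: best_ready_def size_inv_def)
qed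

section \<open>Output and total running time\<close>

definition answer :: "'s set \<Rightarrow> nat \<Rightarrow> nat list" where
  "answer C j = concat (map (\<lambda>k. if nbr k \<subseteq> C then [1, 1] else [0, 1]) [0..<j])"

lemma triple_output:
  "triple (ready C l 0 []) (WhileLess (Reg cJ) (Reg cM) output_body)
     (m * (31 * n + 13 + 1) + 1) (ready C l m (answer C m))"
proof -
  have "triple (ready C l j (answer C j)) output_body (31 * n + 13) (ready C l (Suc j) (answer C (Suc j)))"
    if "j < m" for j
    using triple_output_body[OF that, of C l "answer C j"] by (simp add: answer_def)
  then have "triple (ready C l 0 (answer C 0)) (WhileLess (Reg cJ) (Reg cM) output_body)
     (m * (31 * n + 13 + 1) + 1) (ready C l m (answer C m))"
    by (rule triple_for[where Inv = "\<lambda>j. ready C l j (answer C j)"])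
       (simp_all add: ready_def loaded_def)
  then show ?thesis by (simp add: answer_def)
qed

lemma triple_delegation_com:
  assumes lam: "laminar_states I"
  shows "triple (\<lambda>s y. s = (\<lambda>_. 0) \<and> y = []) delegation_com
    (n * (m * (42 * n + 14) + 4) + m * (31 * n + 14) + 20)
    (\<lambda>s y. \<exists>C. best_cover (weight I) nbr {..<m} C \<and> y = answer C m)"
proof -
  let ?I = "\<lambda>s y. s = (\<lambda>_. 0) \<and> y = []"
  have nbr_pos: "0 < card (nbr k)" if "k < m" for k
  proof -
    have "ss ! k \<in> signals I" using ss that nth_mem by (auto simp only: enumerates_def)
    then have "nbr k \<noteq> {}" using inst by (auto simp: delegation_instance_def)
    moreover have "finite (nbr k)" using nbr_states states(1) finite_subset by blast
    ultimately show ?thesis by (simp add: card_gt_0_iff)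
  qed
  have small: "n < 2 ^ size_bound" "m < 2 ^ size_bound" "n + n < 2 ^ size_bound"
    "n + n + n < 2 ^ size_bound" "n + n + n + 3 < 2 ^ size_bound"
    using m_le length_input by (intro small_numbers; linarith)+
  \<comment> \<open>There are no isolated signals, so nothing precedes size 1 and the empty cover is
    a correct start.\<close>
  have "processed (Suc 0) 0 = {}" using nbr_pos by (auto simp: processed_def)
  then have "best_cover (weight I) nbr (processed (Suc 0) 0) {}"
    by (simp add: best_cover_def)
  then have init: "triple ?I main_init (steps main_init) (size_inv 0)"
    using small cell_sizes
    by (intro triple_wp) (auto simp: main_init_def size_inv_def ready_def loaded_def)
  have loop: "triple (size_inv 0) (WhileLess (Reg cSize) (Reg cN) size_body)
      (n * (m * (42 * n + 14) + 3 + 1) + 1) (size_inv n)"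
    by (rule triple_for[where Inv = size_inv], erule triple_size_body[OF lam])
       (auto simp: size_inv_def ready_def loaded_def)
  \<comment> \<open>This is why \<open>n\<close> rounds treat every signal.\<close>
  have "card (nbr k) \<le> n" for k
    using deg_le[of k n] by (simp add: deg_n)
  then have all: "processed (Suc n) 0 = {..<m}"
    by (auto simp: processed_def less_Suc_eq_le)
  let ?O = "\<lambda>s y. \<exists>C. best_cover (weight I) nbr {..<m} C \<and> ready C n 0 [] s y"
  have mid: "triple (size_inv n) (move cJ (Const 0)) (steps (move cJ (Const 0))) ?O"
    by (rule triple_wp) (auto simp: size_inv_def ready_def loaded_def all)
  have out: "triple ?O (WhileLess (Reg cJ) (Reg cM) output_body) (m * (31 * n + 13 + 1) + 1)
      (\<lambda>s y. \<exists>C. best_cover (weight I) nbr {..<m} C \<and> y = answer C m)"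
  proof (rule triple_ex)
    fix C
    show "triple (\<lambda>s y. best_cover (weight I) nbr {..<m} C \<and> ready C n 0 [] s y)
        (WhileLess (Reg cJ) (Reg cM) output_body) (m * (31 * n + 13 + 1) + 1)
        (\<lambda>s y. \<exists>C. best_cover (weight I) nbr {..<m} C \<and> y = answer C m)"
    proof (cases "best_cover (weight I) nbr {..<m} C")
      case True
      from triple_output show ?thesis
        by (rule triple_conseq) (use True in \<open>auto simp: ready_def\<close>)
    next
      case False
      then show ?thesis by (simp add: triple_def)
    qed
  qed
  from triple_seq[OF init triple_seq[OF loop triple_seq[OF mid out]]] show ?thesis
    unfolding delegation_com_def
    by (rule triple_conseq) (simp_all add: main_init_def add.commute)
qed

lemma best_cover_signals:
  assumes "best_cover w nbr {..<m} C"
  shows "best_cover w (nbrs_signal I) (signals I) C"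
proof -
  have sig: "signals I = (!) ss ` {..<m}"
    using ss by (auto simp: enumerates_def set_conv_nth)
  from assms obtain S where S: "S \<subseteq> {..<m}" "C = \<Union>(nbr ` S)" by (auto simp: best_cover_def)
  have "\<exists>S\<subseteq>signals I. C = \<Union>(nbrs_signal I ` S)"
    using S unfolding sig by (intro exI[of _ "(!) ss ` S"]) (auto simp: image_image)
  moreover have "sum w (\<Union>(nbrs_signal I ` S)) \<le> sum w C" if S: "S \<subseteq> signals I" for S
  proof -
    from S obtain S' where "S' \<subseteq> {..<m}" "S = (!) ss ` S'" unfolding sig by (rule subset_imageE)
    then show ?thesis using assms by (auto simp: best_cover_def image_image)
  qed
  ultimately show ?thesis by (simp add: best_cover_def)
qed

lemma answer_eq_encode_scheme:
  "answer C m = encode_scheme (\<lambda>\<sigma>. if nbrs_signal I \<sigma> \<subseteq> C then 1 else 0) ss"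
proof -
  let ?f = "\<lambda>\<sigma>. if nbrs_signal I \<sigma> \<subseteq> C then [1, 1 :: nat] else [0, 1]"
  have "answer C m = concat (map ?f (map ((!) ss) [0..<m]))"
    by (simp add: answer_def comp_def)
  also have "map ((!) ss) [0..<m] = ss" by (rule map_nth)
  finally show ?thesis
    by (auto simp: encode_scheme_def encode_rat_def intro!: arg_cong[where f = concat])
qed

lemma delegation_com_computes:
  assumes lam: "laminar_states I"
  obtains \<psi> :: "'g \<Rightarrow> rat" and t where "optimal_scheme I (\<lambda>\<sigma>. of_rat (\<psi> \<sigma>))"
    "computes delegation_com input (encode_scheme \<psi> ss) t" "t \<le> 5000 * (input_size input + 1) ^ 4"
proof -
  let ?L = "input_size input"
  let ?T = "n * (m * (42 * n + 14) + 4) + m * (31 * n + 14) + 20"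
  have "bounded (\<lambda>_. 0)" by (simp add: bounded_def)
  with triple_delegation_com[OF lam] obtain t s C where
    exec: "exec input delegation_com (\<lambda>_. 0, []) t (s, answer C m)" and t: "t \<le> 7 * size_bound * ?T"
    and best: "best_cover (weight I) nbr {..<m} C"
    unfolding triple_def by blast
  let ?\<psi> = "\<lambda>\<sigma>. if nbrs_signal I \<sigma> \<subseteq> C then 1 else 0 :: rat"
  show ?thesis
  proof (rule that)
    have "optimal_scheme I (\<lambda>\<sigma>. if nbrs_signal I \<sigma> \<subseteq> C then 1 else 0)"
      using inst best_cover_signals[OF best] by (rule optimal_scheme_best_cover)
    moreover have "(\<lambda>\<sigma>. of_rat (?\<psi> \<sigma>) :: real) = (\<lambda>\<sigma>. if nbrs_signal I \<sigma> \<subseteq> C then 1 else 0)"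
      by auto
    ultimately show "optimal_scheme I (\<lambda>\<sigma>. of_rat (?\<psi> \<sigma>))" by simp
    show "computes delegation_com input (encode_scheme ?\<psi> ss) t"
      using exec unfolding computes_def answer_eq_encode_scheme by blast
    have le: "n \<le> ?L" "m \<le> ?L"
      using length_input length_input_le m_le by linarith+
    \<comment> \<open>Being at least 1 and an upper bound for \<open>n\<close> and \<open>m\<close>,
      \<open>k\<close> absorbs all terms of lower order.\<close>
    define k where "k = ?L + 1"
    have k: "1 \<le> k" "1 \<le> k * k" "1 \<le> k * k * k" "k * k \<le> k * k * k" by (simp_all add: k_def)
    have "42 * n + 14 \<le> 56 * k" "31 * n + 14 \<le> 45 * k" "n \<le> k" "m \<le> k"
      using le by (simp_all add: k_def)
    then have "m * (42 * n + 14) \<le> k * (56 * k)" "m * (31 * n + 14) \<le> k * (45 * k)"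
      by (intro mult_le_mono; simp)+
    moreover from this \<open>n \<le> k\<close> have "n * (m * (42 * n + 14) + 4) \<le> k * (60 * (k * k))"
      using k(2) by (intro mult_le_mono) linarith+
    ultimately have "?T \<le> k * (60 * (k * k)) + k * (45 * k) + 20"
      by (intro add_mono order_refl)
    also have "\<dots> = 60 * (k * k * k) + 45 * (k * k) + 20" by simp
    also have "\<dots> \<le> 125 * (k * k * k)" using k(3,4) by linarith
    finally have T: "?T \<le> 125 * (k * k * k)" .
    \<comment> \<open>The bit length contributes the fourth factor \<open>k\<close>:
      \<open>?L + 5\<close> is at most \<open>5 * k\<close>. The product 35 * 125 = 4375 is rounded
      up to 5000.\<close>
    have "7 * size_bound \<le> 35 * k" by (simp add: k_def)
    then have "7 * size_bound * ?T \<le> 35 * k * (125 * (k * k * k))"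
      using T by (rule mult_le_mono)
    also have "\<dots> \<le> 5000 * k ^ 4" by (simp add: power4_eq_xxxx)
    finally show "t \<le> 5000 * (?L + 1) ^ 4" using t unfolding k_def by (rule order_trans[rotated])
  qed
qed

end

theorem theorem4p10:
  shows "\<exists>(c :: com) (P :: nat poly). \<forall>(I :: (nat, nat) delegation) ts ss.
    delegation_instance I \<longrightarrow> laminar_states I \<longrightarrow>
    enumerates ts (states I) \<longrightarrow> enumerates ss (signals I) \<longrightarrow>
    (\<exists>(\<psi> :: nat \<Rightarrow> rat) t.
       optimal_scheme I (\<lambda>\<sigma>. of_rat (\<psi> \<sigma>)) \<and>
       computes c (encode_instance I ts ss) (encode_scheme \<psi> ss) t \<and>
       t \<le> poly P (input_size (encode_instance I ts ss)))"
proof (intro exI[of _ delegation_com] exI[of _ "[:5000:] * [:1, 1:] ^ 4"] allI impI)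
  fix I :: "(nat, nat) delegation" and ts ss
  assume "delegation_instance I" "enumerates ts (states I)" "enumerates ss (signals I)"
    and lam: "laminar_states I"
  then interpret enumerated_instance I ts ss by unfold_locales
  from delegation_com_computes[OF lam] obtain \<psi> t where
    "optimal_scheme I (\<lambda>\<sigma>. of_rat (\<psi> \<sigma>))" "computes delegation_com input (encode_scheme \<psi> ss) t"
    "t \<le> 5000 * (input_size input + 1) ^ 4" .
  then show "\<exists>(\<psi> :: nat \<Rightarrow> rat) t. optimal_scheme I (\<lambda>\<sigma>. of_rat (\<psi> \<sigma>)) \<and>
      computes delegation_com input (encode_scheme \<psi> ss) t \<and>
      t \<le> poly ([:5000:] * [:1, 1:] ^ 4) (input_size input)"
    by (intro exI[of _ \<psi>] exI[of _ t]) (simp add: poly_power add.commute)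
qed

end
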